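(* There exists an absolute constant $C>0$ such that for every function $f:\mathbb{Z}\to\mathbb{R}$ of bounded variation (that is, $\operatorname{var} f<\infty$) one has $$\operatorname{var} Mf\leq C\,\operatorname{var} f .$$
   Context: For $g:\mathbb{Z}\to\mathbb{R}$ the variation is $\operatorname{var} g:=\sum_{k\in\mathbb{Z}}|g(k+1)-g(k)|$. The (centered) discrete Hardy-Littlewood maximal function of $f:\mathbb{Z}\to\mathbb{R}$ is $$Mf(n)=\sup_{r}\frac{1}{2r+1}\sum_{k=-r}^{r}|f(n+k)|,\qquad n\in\mathbb{Z},$$ where the supremum is over all integers $r\geq 0$. *)

theory Defs
  imports "HOL-Analysis.Analysis"
begin

text \<open>
  The sum is taken in \<^typ>\<open>ennreal\<close>, where it always exists (as the supremum of the finite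
  partial sums); hence finite variation is the condition \<open>variation g < \<infinity>\<close>.
\<close>

definition variation :: "(int \<Rightarrow> real) \<Rightarrow> ennreal" where
  "variation g = (\<Sum>\<^sub>\<infinity>k\<in>UNIV. ennreal \<bar>g (k + 1) - g k\<bar>)"

definition bounded_variation :: "(int \<Rightarrow> real) \<Rightarrow> bool" where
  "bounded_variation g \<longleftrightarrow> variation g < \<infinity>"

definition centered_average :: "(int \<Rightarrow> real) \<Rightarrow> int \<Rightarrow> nat \<Rightarrow> real" where
  "centered_average f n r = (\<Sum>k = - int r..int r. \<bar>f (n + k)\<bar>) / (2 * real r + 1)"

text \<open>
  The supremum is the real one, so it is meaningful only where the averages are bounded above.
  This is so for every function of bounded variation, see
  \<open>bdd_above_centered_average\<close> below.
\<close>

definition maximal_function :: "(int \<Rightarrow> real) \<Rightarrow> int \<Rightarrow> real" where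
  "maximal_function f n = (SUP r. centered_average f n r)"

lemma bounded_variation_imp_bounded:
  assumes "bounded_variation f"
  shows "\<exists>B. \<forall>n. \<bar>f n\<bar> \<le> B"
proof -
  define V where "V = enn2real (variation f)"
  have V: "variation f = ennreal V"
    using assms unfolding bounded_variation_def V_def by (simp add: less_top)
  have V0: "V \<ge> 0" by (simp add: V_def)
  have fin: "(\<Sum>k\<in>F. \<bar>f (k + 1) - f k\<bar>) \<le> V" if "finite F" for F :: "int set"
  proof -
    have "(\<Sum>k\<in>F. ennreal \<bar>f (k + 1) - f k\<bar>) \<le> variation f"
      unfolding variation_def using that
      by (subst nonneg_infsum_complete) (auto intro!: SUP_upper)
    then show ?thesis using V0 by (simp add: V sum_ennreal)
  qed
  have tele: "\<bar>f (a + int m) - f a\<bar> \<le> (\<Sum>k\<in>{a..<a + int m}. \<bar>f (k + 1) - f k\<bar>)" for a m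
  proof (induction m)
    case (Suc m)
    have "{a..<a + int (Suc m)} = insert (a + int m) {a..<a + int m}" by auto
    then show ?case using Suc by (simp add: algebra_simps)
  qed simp
  have "\<bar>f n\<bar> \<le> \<bar>f 0\<bar> + V" for n
  proof (cases "n \<ge> 0")
    case True
    then show ?thesis using tele[of 0 "nat n"] fin[of "{0..<n}"] by simp
  next
    case False
    then show ?thesis using tele[of n "nat (- n)"] fin[of "{n..<0}"] by simp
  qed
  then show ?thesis by blast
qed

lemma bdd_above_centered_average:
  assumes "bounded_variation f"
  shows "bdd_above (range (centered_average f n))"
proof -
  obtain B where B: "\<And>k. \<bar>f k\<bar> \<le> B"
    using bounded_variation_imp_bounded[OF assms] by blast
  have "centered_average f n r \<le> B" for r
  proof -
    have "(\<Sum>k = - int r..int r. \<bar>f (n + k)\<bar>) \<le> real (card {- int r..int r}) * B"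
      by (rule sum_bounded_above) (rule B)
    then show ?thesis
      unfolding centered_average_def by (simp add: field_simps)
  qed
  then show ?thesis by (auto intro: bdd_aboveI[where M = B])
qed

end

theory Submission
  imports Defs
begin

text \<open>
  Let \<open>F = \<bar>f\<bar>\<close>, let \<open>u\<close> be the maximal function and let \<open>V\<close> be the variation of \<open>f\<close>, which bounds
  that of \<open>F\<close>. A rise of \<open>u\<close> is of one of three kinds: it is paid for by a rise of \<open>F\<close> itself; it
  belongs to the oscillation of \<open>u\<close>, which is at most \<open>V\<close>; or it belongs to a \<^emph>\<open>peak\<close>, points \<open>p <
  r < q\<close> and a level \<open>l\<close> with \<open>u p, u q \<le> l\<close> and \<open>F \<le> l\<close> between \<open>p\<close> and \<open>q\<close>, while an average of
  \<open>F\<close> around \<open>r\<close> exceeds \<open>l + D\<close>. Falls of \<open>u\<close> amount to as much as the rises, up to the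
  oscillation of \<open>u\<close>. Only the peaks are difficult. The radius \<open>w\<close> of the average is at least the
  distance from \<open>r\<close> to \<open>p\<close> and to \<open>q\<close> (\<open>peak_radius\<close>), so peaks reflect what \<open>F\<close> does away from
  them, near the two ends of the ball around \<open>r\<close>, and many peaks of many different scales may
  reflect the same part of \<open>F\<close>.

  The ball around \<open>r\<close> has an average above \<open>l + D\<close>, but moving one end of it by twice the distance
  from \<open>r\<close> to \<open>p\<close> gives a ball around \<open>p\<close>, whose average is at most \<open>l\<close>; similarly for \<open>q\<close>. Hence
  \<open>F\<close> jumps across the level \<open>l\<close> at both ends of the ball, upwards at the left end and downwards at
  the right end, and the jump is about \<open>w / 2 ^ j\<close> times larger than \<open>D\<close>, where \<open>2 ^ j\<close> is the
  width of the peak. If many peaks of width \<open>2 ^ j\<close> with centers in a block of length comparable to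
  \<open>w\<close> use the same end, then they must differ in the other end. Quantitatively, a weighted form of
  the Erdos-Szekeres theorem selects a chain of peaks with monotone radii; along such a chain one
  of the two ends moves steadily, so the jumps at that end take place in disjoint intervals, and
  the chain carries enough of the total. The result is \<open>block_gain\<close>: on the window of the block,
  \<open>F\<close> both rises and falls, over intervals of length at least \<open>2 ^ j\<close>, by a constant times \<open>sqrt (2
  ^ e) * (\<Sum> D)\<close>, where \<open>2 ^ e\<close> is about \<open>w / 2 ^ j\<close>.

  Rises and falls at different scales have to be counted without overlap, although the windows of
  different scales overlap. This is done by duality: \<open>(\<Sum> g x * (F (x + 1) - F x)) \<le> V\<close> for every
  \<open>g\<close> with \<open>\<bar>g\<bar> \<le> 1\<close>. A function \<open>g\<close> is built from coarse to fine scales. On a window of the next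
  scale the function constructed so far is nearly constant, so either half a test function that
  detects the rises can be added to it, or half a test function that detects the falls can be
  subtracted; for this choice \<^emph>\<open>both\<close> rises and falls are needed. Thus the gains of all scales add
  up (\<open>multiscale_gain\<close>), provided that the scales are about \<open>e\<close> apart. For a fixed \<open>e\<close> this costs
  a factor of about \<open>e\<close>, against which \<open>block_gain\<close> has a factor \<open>sqrt (2 ^ e)\<close> to offer, and the
  sum over \<open>e\<close> converges (\<open>all_peaks_bound\<close>).
\<close>

section \<open>Test functions\<close>

text \<open>
  The sum is minus the pairing of \<open>f\<close> with the increments of \<open>\<psi>\<close>. It is large when \<open>f\<close> is small
  where \<open>\<psi>\<close> increases and large where \<open>\<psi>\<close> decreases, that is, when \<open>f\<close> rises by \<open>X\<close> in total, seen
  at lengths not below \<open>1 / c\<close>. Falls of \<open>f\<close> are described by the same predicate for \<open>- f\<close>.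
\<close>

definition test_gain :: "(int \<Rightarrow> real) \<Rightarrow> int \<Rightarrow> int \<Rightarrow> real \<Rightarrow> real \<Rightarrow> bool" where
  "test_gain f lo hi c X \<longleftrightarrow> (\<exists>\<psi>. (\<forall>x. 0 \<le> \<psi> x \<and> \<psi> x \<le> 1) \<and> (\<forall>x. x < lo \<or> hi \<le> x \<longrightarrow> \<psi> x = 0) \<and>
     (\<forall>x. \<bar>\<psi> (x + 1) - \<psi> x\<bar> \<le> c) \<and> X \<le> (\<Sum>x\<in>{lo..<hi}. \<psi> x * (f (x + 1) - f x)))"

lemma test_gain_mono:
  assumes "test_gain f lo hi c X" "lo' \<le> lo" "hi \<le> hi'" "c \<le> c'" "X' \<le> X"
  shows "test_gain f lo' hi' c' X'"
proof -
  obtain \<psi> where \<psi>: "\<And>x. 0 \<le> \<psi> x \<and> \<psi> x \<le> 1" "\<And>x. x < lo \<or> hi \<le> x \<Longrightarrow> \<psi> x = 0"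
    "\<And>x. \<bar>\<psi> (x + 1) - \<psi> x\<bar> \<le> c" "X \<le> (\<Sum>x\<in>{lo..<hi}. \<psi> x * (f (x + 1) - f x))"
    using assms(1) unfolding test_gain_def by blast
  have "(\<Sum>x\<in>{lo..<hi}. \<psi> x * (f (x + 1) - f x)) = (\<Sum>x\<in>{lo'..<hi'}. \<psi> x * (f (x + 1) - f x))"
    by (rule sum.mono_neutral_left) (use assms \<psi>(2) in auto)
  then show ?thesis
    unfolding test_gain_def using \<psi> assms
    by (intro exI[of _ \<psi>]) (auto intro: order_trans)
qed

text \<open>
  The supports are disjoint. In the step across the meeting point one test function falls to \<open>0\<close>
  while the other one starts from \<open>0\<close>; these changes have opposite signs, so the step bound \<open>c\<close>
  survives.
\<close>

lemma test_gain_append: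
  assumes "test_gain f lo mid c X" "test_gain f mid hi c Y" "lo \<le> mid" "mid \<le> hi"
  shows "test_gain f lo hi c (X + Y)"
proof -
  obtain \<psi> where \<psi>: "\<And>x. 0 \<le> \<psi> x" "\<And>x. \<psi> x \<le> 1" "\<And>x. x < lo \<or> mid \<le> x \<Longrightarrow> \<psi> x = 0"
    "\<And>x. \<bar>\<psi> (x + 1) - \<psi> x\<bar> \<le> c" "X \<le> (\<Sum>x\<in>{lo..<mid}. \<psi> x * (f (x + 1) - f x))"
    using assms(1) unfolding test_gain_def by blast
  obtain \<phi> where \<phi>: "\<And>x. 0 \<le> \<phi> x" "\<And>x. \<phi> x \<le> 1" "\<And>x. x < mid \<or> hi \<le> x \<Longrightarrow> \<phi> x = 0"
    "\<And>x. \<bar>\<phi> (x + 1) - \<phi> x\<bar> \<le> c" "Y \<le> (\<Sum>x\<in>{mid..<hi}. \<phi> x * (f (x + 1) - f x))"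
    using assms(2) unfolding test_gain_def by blast
  define \<eta> where "\<eta> x = \<psi> x + \<phi> x" for x
  have ca: "\<psi> x = 0 \<or> \<phi> x = 0" for x using \<psi>(3)[of x] \<phi>(3)[of x] by linarith
  have 1: "0 \<le> \<eta> x \<and> \<eta> x \<le> 1" for x
    using ca[of x] \<psi>(1,2)[of x] \<phi>(1,2)[of x] unfolding \<eta>_def by auto
  have 2: "\<bar>\<eta> (x + 1) - \<eta> x\<bar> \<le> c" for x
  proof -
    consider "x + 1 < mid" | "x + 1 = mid" | "mid \<le> x" by linarith
    then show ?thesis
    proof cases
      case 1 then show ?thesis using \<psi>(4)[of x] \<phi>(3)[of x] \<phi>(3)[of "x+1"] by (simp add: \<eta>_def)
    next
      case 2 then show ?thesis
        using \<psi>(4)[of x] \<phi>(4)[of x] \<phi>(3)[of x] \<psi>(3)[of "x+1"] \<psi>(1)[of x] \<phi>(1)[of "x+1"]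
        by (simp add: \<eta>_def)
    next
      case 3 then show ?thesis using \<phi>(4)[of x] \<psi>(3)[of x] \<psi>(3)[of "x+1"] by (simp add: \<eta>_def)
    qed
  qed
  have 3: "x < lo \<or> hi \<le> x \<longrightarrow> \<eta> x = 0" for x
    using \<psi>(3)[of x] \<phi>(3)[of x] assms(3,4) by (auto simp: \<eta>_def)
  have "(\<Sum>x\<in>{lo..<hi}. \<eta> x * (f (x + 1) - f x)) =
      (\<Sum>x\<in>{lo..<hi}. \<psi> x * (f (x + 1) - f x)) + (\<Sum>x\<in>{lo..<hi}. \<phi> x * (f (x + 1) - f x))"
    by (simp add: \<eta>_def algebra_simps flip: sum.distrib)
  also have "(\<Sum>x\<in>{lo..<hi}. \<psi> x * (f (x + 1) - f x)) = (\<Sum>x\<in>{lo..<mid}. \<psi> x * (f (x + 1) - f x))"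
    by (rule sum.mono_neutral_right) (use assms \<psi>(3) in auto)
  also have "(\<Sum>x\<in>{lo..<hi}. \<phi> x * (f (x + 1) - f x)) = (\<Sum>x\<in>{mid..<hi}. \<phi> x * (f (x + 1) - f x))"
    by (rule sum.mono_neutral_right) (use assms \<phi>(3) in auto)
  finally show ?thesis
    unfolding test_gain_def using 1 2 3 \<psi>(5) \<phi>(5) by (intro exI[of _ \<eta>]) auto
qed

lemma test_gain_zero: "c \<ge> 0 \<Longrightarrow> test_gain f lo hi c 0"
  unfolding test_gain_def by (intro exI[of _ "\<lambda>_. 0"]) auto

lemma sum_int_ivl_split:
  fixes f :: "int \<Rightarrow> 'a::comm_monoid_add"
  assumes "a \<le> b" "b \<le> c"
  shows "sum f {a..<b} + sum f {b..<c} = sum f {a..<c}"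
proof -
  have "{a..<c} = {a..<b} \<union> {b..<c}" using assms by auto
  then show ?thesis by (simp add: sum.union_disjoint)
qed

text \<open>
  The value at \<open>x\<close> is the share of the interval \<open>{s..<t}\<close> that lies in \<open>{..x}\<close>, so that the
  increments form the normalized indicator of the interval. This is what makes summation by parts
  produce a mean.
\<close>

definition ramp :: "int \<Rightarrow> int \<Rightarrow> int \<Rightarrow> real" where
  "ramp s t x = (if x < s then 0 else if t \<le> x then 1 else real_of_int (x + 1 - s) / real_of_int (t - s))"

lemma sum_linear_increments:
  fixes f :: "int \<Rightarrow> real"
  shows "(\<Sum>x\<in>{s..<s + int n}. real_of_int (x + 1 - s) * (f (x + 1) - f x)) =
     real n * f (s + int n) - sum f {s..<s + int n}"
proof (induction n)
  case (Suc n)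
  have "{s..<s + int (Suc n)} = insert (s + int n) {s..<s + int n}" by auto
  then show ?case using Suc by (simp add: algebra_simps)
qed simp

lemma sum_increments:
  fixes f :: "int \<Rightarrow> real"
  assumes "s \<le> t"
  shows "(\<Sum>x\<in>{s..<t}. f (x + 1) - f x) = f t - f s"
proof -
  have "(\<Sum>x\<in>{s..<s + int n}. f (x + 1) - f x) = f (s + int n) - f s" for n
  proof (induction n)
    case (Suc n)
    have "{s..<s + int (Suc n)} = insert (s + int n) {s..<s + int n}" by auto
    then show ?case using Suc by (simp add: algebra_simps)
  qed simp
  from this[of "nat (t - s)"] show ?thesis using assms by simp
qed

lemma sum_ramp_increments:
  fixes f :: "int \<Rightarrow> real"
  assumes "lo \<le> s" "s < t" "t \<le> hi"
  shows "(\<Sum>x\<in>{lo..<hi}. ramp s t x * (f (x + 1) - f x)) = f hi - sum f {s..<t} / real_of_int (t - s)"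
proof -
  let ?g = "\<lambda>x. ramp s t x * (f (x + 1) - f x)"
  have "sum ?g {lo..<hi} = sum ?g {lo..<s} + sum ?g {s..<t} + sum ?g {t..<hi}"
    using assms by (simp add: sum_int_ivl_split)
  also have "sum ?g {lo..<s} = 0" by (intro sum.neutral) (auto simp: ramp_def)
  also have "sum ?g {t..<hi} = (\<Sum>x\<in>{t..<hi}. f (x + 1) - f x)"
    by (intro sum.cong) (use assms in \<open>auto simp: ramp_def\<close>)
  also have "\<dots> = f hi - f t" using assms by (intro sum_increments) auto
  also have "sum ?g {s..<t} = (\<Sum>x\<in>{s..<t}. real_of_int (x + 1 - s) * (f (x + 1) - f x)) / real_of_int (t - s)"
    by (subst sum_divide_distrib) (intro sum.cong, auto simp: ramp_def)
  also have "(\<Sum>x\<in>{s..<t}. real_of_int (x + 1 - s) * (f (x + 1) - f x)) =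
      real_of_int (t - s) * f t - sum f {s..<t}"
    using sum_linear_increments[where s = s and n = "nat (t - s)" and f = f] assms by simp
  finally show ?thesis using assms by (simp add: diff_divide_distrib)
qed

lemma ramp_bounds: "s < t \<Longrightarrow> 0 \<le> ramp s t x" "s < t \<Longrightarrow> ramp s t x \<le> 1"
  by (auto simp: ramp_def divide_simps)

lemma ramp_step:
  assumes "s < t"
  shows "ramp s t (x + 1) - ramp s t x = (if s \<le> x + 1 \<and> x + 1 < t then 1 / real_of_int (t - s) else 0)"
proof -
  consider "x + 1 < s" | "x + 1 = s" | "s \<le> x" "x + 1 < t" | "x + 1 = t" "s \<le> x" | "t \<le> x" by linarith
  then show ?thesis using assms
    by cases (auto simp: ramp_def divide_simps)
qed

text \<open>
  The difference of two ramps is a trapezoid, and its pairing with the increments of \<open>f\<close> is the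
  difference of the means over the two intervals.
\<close>

lemma test_gain_ascent:
  fixes f :: "int \<Rightarrow> real"
  assumes "lo \<le> s" "s < t" "t \<le> s'" "s' < t'" "t' \<le> hi"
    and c: "1 / real_of_int (t - s) \<le> c" "1 / real_of_int (t' - s') \<le> c"
    and X: "X \<le> sum f {s'..<t'} / real_of_int (t' - s') - sum f {s..<t} / real_of_int (t - s)"
  shows "test_gain f lo hi c X"
proof -
  define \<psi> where "\<psi> x = ramp s t x - ramp s' t' x" for x
  have one: "ramp s t x = 1" if "s' \<le> x" for x using that assms by (simp add: ramp_def)
  have zero: "ramp s' t' x = 0" if "x < s'" for x using that by (simp add: ramp_def)
  have 1: "0 \<le> \<psi> x \<and> \<psi> x \<le> 1" for x
    using one[of x] zero[of x] ramp_bounds[of s t x] ramp_bounds[of s' t' x] assms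
    by (cases "x < s'") (auto simp: \<psi>_def)
  have 2: "x < lo \<or> hi \<le> x \<longrightarrow> \<psi> x = 0" for x
    using assms by (auto simp: \<psi>_def ramp_def)
  have c0: "0 \<le> c" using c(1) assms(2) by (smt (verit) divide_nonneg_nonneg of_int_0_le_iff)
  have 3: "\<bar>\<psi> (x + 1) - \<psi> x\<bar> \<le> c" for x
  proof -
    have "\<psi> (x + 1) - \<psi> x = (ramp s t (x + 1) - ramp s t x) - (ramp s' t' (x + 1) - ramp s' t' x)"
      by (simp add: \<psi>_def)
    then show ?thesis
      using assms c0 by (simp add: ramp_step)
  qed
  have "(\<Sum>x\<in>{lo..<hi}. \<psi> x * (f (x + 1) - f x)) =
     (\<Sum>x\<in>{lo..<hi}. ramp s t x * (f (x + 1) - f x)) - (\<Sum>x\<in>{lo..<hi}. ramp s' t' x * (f (x + 1) - f x))"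
    by (simp add: \<psi>_def algebra_simps flip: sum_subtractf)
  also have "\<dots> = sum f {s'..<t'} / real_of_int (t' - s') - sum f {s..<t} / real_of_int (t - s)"
    using assms by (simp only: sum_ramp_increments)
  finally show ?thesis unfolding test_gain_def using 1 2 3 X by (intro exI[of _ \<psi>]) auto
qed

section \<open>Collecting gains over many scales\<close>

text \<open>
  Rises and falls are both available on each window, and this leaves the sign of the correction
  free. As \<open>g\<close> oscillates by at most \<open>1\<close> on a window, it stays above \<open>- 1/2\<close> or below \<open>1/2\<close> there,
  and a correction of size at most \<open>1/2\<close> with the right sign respects the bound \<open>1\<close>.
\<close>

lemma one_scale_step:
  fixes F g :: "int \<Rightarrow> real"
  assumes fin: "finite K" and c0: "0 \<le> c"
    and gb: "\<And>x. \<bar>g x\<bar> \<le> 1"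
    and osc: "\<And>k x y. k \<in> K \<Longrightarrow> x \<in> {lo k..<hi k} \<Longrightarrow> y \<in> {lo k..<hi k} \<Longrightarrow> g x - g y \<le> 1"
    and sep: "\<And>k k'. k \<in> K \<Longrightarrow> k' \<in> K \<Longrightarrow> k \<noteq> k' \<Longrightarrow> hi k < lo k' \<or> hi k' < lo k"
    and up: "\<And>k. k \<in> K \<Longrightarrow> test_gain F (lo k) (hi k) c (X k)"
    and down: "\<And>k. k \<in> K \<Longrightarrow> test_gain (\<lambda>x. - F x) (lo k) (hi k) c (X k)"
    and rng: "\<And>k. k \<in> K \<Longrightarrow> L0 \<le> lo k \<and> hi k \<le> H0"
  shows "\<exists>g'. (\<forall>x. \<bar>g' x\<bar> \<le> 1) \<and> (\<forall>x. \<bar>g' (x + 1) - g' x\<bar> \<le> \<bar>g (x + 1) - g x\<bar> + c / 2) \<and>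
     (\<Sum>x\<in>{L0..<H0}. g' x * (F (x + 1) - F x)) \<ge>
     (\<Sum>x\<in>{L0..<H0}. g x * (F (x + 1) - F x)) + (\<Sum>k\<in>K. X k) / 2"
proof -
  have "\<exists>\<eta>. (\<forall>x. \<bar>g x + \<eta> x / 2\<bar> \<le> 1) \<and> (\<forall>x. x < lo k \<or> hi k \<le> x \<longrightarrow> \<eta> x = 0) \<and>
     (\<forall>x. \<bar>\<eta> (x + 1) - \<eta> x\<bar> \<le> c) \<and> X k \<le> (\<Sum>x\<in>{L0..<H0}. \<eta> x * (F (x + 1) - F x))"
    if k: "k \<in> K" for k
  proof (cases "\<forall>x\<in>{lo k..<hi k}. g x \<ge> - 1/2")
    case True
    obtain \<psi> where \<psi>: "\<And>x. 0 \<le> \<psi> x" "\<And>x. \<psi> x \<le> 1" "\<And>x. x < lo k \<or> hi k \<le> x \<Longrightarrow> \<psi> x = 0"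
      "\<And>x. \<bar>\<psi> (x + 1) - \<psi> x\<bar> \<le> c" "X k \<le> (\<Sum>x\<in>{lo k..<hi k}. \<psi> x * (- F (x + 1) - (- F x)))"
      using down[OF k] unfolding test_gain_def by blast
    have "(\<Sum>x\<in>{lo k..<hi k}. \<psi> x * (- F (x + 1) - (- F x))) = (\<Sum>x\<in>{lo k..<hi k}. - \<psi> x * (F (x + 1) - F x))"
      by (intro sum.cong) (auto simp: algebra_simps)
    also have "\<dots> = (\<Sum>x\<in>{L0..<H0}. - \<psi> x * (F (x + 1) - F x))"
      by (rule sum.mono_neutral_left) (use rng[OF k] \<psi>(3) in auto)
    finally have *: "X k \<le> (\<Sum>x\<in>{L0..<H0}. - \<psi> x * (F (x + 1) - F x))" using \<psi>(5) by simp
    have **: "\<bar>g x + - \<psi> x / 2\<bar> \<le> 1" for x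
    proof (cases "x \<in> {lo k..<hi k}")
      case True
      then have "g x \<ge> -1/2" using \<open>\<forall>x\<in>_. _\<close> by blast
      then show ?thesis using \<psi>(1,2)[of x] gb[of x] by (auto simp: abs_le_iff)
    next
      case False then show ?thesis using \<psi>(3)[of x] gb[of x] by auto
    qed
    show ?thesis
      by (intro exI[of _ "\<lambda>x. - \<psi> x"]) (use * ** \<psi>(3,4) in \<open>auto simp: abs_le_iff algebra_simps\<close>)
  next
    case False
    then obtain y where y: "y \<in> {lo k..<hi k}" "g y < -1/2" by auto
    obtain \<psi> where \<psi>: "\<And>x. 0 \<le> \<psi> x" "\<And>x. \<psi> x \<le> 1" "\<And>x. x < lo k \<or> hi k \<le> x \<Longrightarrow> \<psi> x = 0"
      "\<And>x. \<bar>\<psi> (x + 1) - \<psi> x\<bar> \<le> c" "X k \<le> (\<Sum>x\<in>{lo k..<hi k}. \<psi> x * (F (x + 1) - F x))"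
      using up[OF k] unfolding test_gain_def by blast
    have "(\<Sum>x\<in>{lo k..<hi k}. \<psi> x * (F (x + 1) - F x)) = (\<Sum>x\<in>{L0..<H0}. \<psi> x * (F (x + 1) - F x))"
      by (rule sum.mono_neutral_left) (use rng[OF k] \<psi>(3) in auto)
    then have *: "X k \<le> (\<Sum>x\<in>{L0..<H0}. \<psi> x * (F (x + 1) - F x))" using \<psi>(5) by simp
    have **: "\<bar>g x + \<psi> x / 2\<bar> \<le> 1" for x
    proof (cases "x \<in> {lo k..<hi k}")
      case True
      then have "g x \<le> 1/2" using osc[OF k True y(1)] y(2) by linarith
      then show ?thesis using \<psi>(1,2)[of x] gb[of x] by (auto simp: abs_le_iff)
    next
      case False then show ?thesis using \<psi>(3)[of x] gb[of x] by auto
    qed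
    show ?thesis
      by (intro exI[of _ "\<psi>"]) (use * ** \<psi>(3,4) in auto)
  qed
  then have "\<forall>k\<in>K. \<exists>\<eta>. (\<forall>x. \<bar>g x + \<eta> x / 2\<bar> \<le> 1) \<and> (\<forall>x. x < lo k \<or> hi k \<le> x \<longrightarrow> \<eta> x = 0) \<and>
     (\<forall>x. \<bar>\<eta> (x + 1) - \<eta> x\<bar> \<le> c) \<and> X k \<le> (\<Sum>x\<in>{L0..<H0}. \<eta> x * (F (x + 1) - F x))"
    by blast
  from bchoice[OF this] obtain \<eta> where "\<forall>k\<in>K. (\<forall>x. \<bar>g x + \<eta> k x / 2\<bar> \<le> 1) \<and>
     (\<forall>x. x < lo k \<or> hi k \<le> x \<longrightarrow> \<eta> k x = 0) \<and> (\<forall>x. \<bar>\<eta> k (x + 1) - \<eta> k x\<bar> \<le> c) \<and>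
     X k \<le> (\<Sum>x\<in>{L0..<H0}. \<eta> k x * (F (x + 1) - F x))" ..
  then have \<eta>: "\<And>k x. k \<in> K \<Longrightarrow> \<bar>g x + \<eta> k x / 2\<bar> \<le> 1"
     "\<And>k x. k \<in> K \<Longrightarrow> x < lo k \<or> hi k \<le> x \<Longrightarrow> \<eta> k x = 0"
     "\<And>k x. k \<in> K \<Longrightarrow> \<bar>\<eta> k (x + 1) - \<eta> k x\<bar> \<le> c"
     "\<And>k. k \<in> K \<Longrightarrow> X k \<le> (\<Sum>x\<in>{L0..<H0}. \<eta> k x * (F (x + 1) - F x))"
    by blast+
  \<comment> \<open>Gaps between the windows ensure that two neighbouring points never see two different corrections.\<close>
  define \<phi> where "\<phi> x = (\<Sum>k\<in>K. \<eta> k x)" for x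
  have at: "(\<exists>k\<in>K. \<phi> x = \<eta> k x \<and> \<phi> (x + 1) = \<eta> k (x + 1)) \<or> (\<phi> x = 0 \<and> \<phi> (x + 1) = 0)" for x
  proof (cases "\<exists>k\<in>K. lo k \<le> x + 1 \<and> x < hi k")
    case True
    then obtain k where k: "k \<in> K" "lo k \<le> x + 1" "x < hi k" by blast
    have z: "\<eta> k' y = 0" if "k' \<in> K - {k}" "y = x \<or> y = x + 1" for k' y
      using sep[of k k'] k \<eta>(2)[of k' y] that by auto
    have "\<phi> y = \<eta> k y" if "y = x \<or> y = x + 1" for y
      unfolding \<phi>_def using fin k(1) z[OF _ that] by (subst sum.remove[of _ k]) auto
    then show ?thesis using k(1) by blast
  next
    case False
    then have "\<phi> x = 0" "\<phi> (x + 1) = 0" unfolding \<phi>_def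
      by (auto intro!: sum.neutral \<eta>(2))
    then show ?thesis by blast
  qed
  have "\<bar>g x + \<phi> x / 2\<bar> \<le> 1" for x
    using at[of x] by (elim disjE bexE) (use \<eta>(1)[of _ x] gb[of x] in auto)
  moreover have "\<bar>(g (x + 1) + \<phi> (x + 1) / 2) - (g x + \<phi> x / 2)\<bar> \<le> \<bar>g (x + 1) - g x\<bar> + c / 2" for x
  proof -
    have "\<bar>\<phi> (x + 1) - \<phi> x\<bar> \<le> c" using at[of x] \<eta>(3)[of _ x] c0 by auto
    then show ?thesis by (simp add: abs_le_iff) linarith
  qed
  moreover have "(\<Sum>x\<in>{L0..<H0}. (g x + \<phi> x / 2) * (F (x + 1) - F x)) \<ge>
     (\<Sum>x\<in>{L0..<H0}. g x * (F (x + 1) - F x)) + (\<Sum>k\<in>K. X k) / 2"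
  proof -
    have "(\<Sum>k\<in>K. X k) \<le> (\<Sum>k\<in>K. \<Sum>x\<in>{L0..<H0}. \<eta> k x * (F (x + 1) - F x))"
      by (intro sum_mono \<eta>(4))
    also have "\<dots> = (\<Sum>x\<in>{L0..<H0}. \<phi> x * (F (x + 1) - F x))"
      unfolding \<phi>_def by (subst sum.swap) (simp add: sum_distrib_right)
    finally have "(\<Sum>k\<in>K. X k) / 2 \<le> (\<Sum>x\<in>{L0..<H0}. \<phi> x / 2 * (F (x + 1) - F x))"
      by (simp flip: sum_divide_distrib)
    then show ?thesis by (simp add: distrib_right sum.distrib)
  qed
  ultimately show ?thesis by (intro exI[of _ "\<lambda>x. g x + \<phi> x / 2"]) blast
qed

lemma increments_le_distance:
  fixes g :: "int \<Rightarrow> real"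
  assumes "\<And>x. \<bar>g (x + 1) - g x\<bar> \<le> c"
  shows "\<bar>g x - g y\<bar> \<le> c * \<bar>real_of_int (x - y)\<bar>"
proof -
  have *: "\<bar>g (y + int n) - g y\<bar> \<le> c * real n" for y n
  proof (induction n)
    case (Suc n)
    then show ?case using assms[of "y + int n"] by (simp add: algebra_simps)
  qed simp
  show ?thesis
  proof (cases "y \<le> x")
    case True then show ?thesis using *[of y "nat (x - y)"] by simp
  next
    case False then show ?thesis using *[of x "nat (y - x)"] by (simp add: abs_minus_commute)
  qed
qed

text \<open>
  The steps of the function built at the scales above \<open>n\<close> are at most half of \<open>2 ^ e / 2 ^ (n +
  1)\<close>, by summing a geometric series. With \<open>e + 4\<close> between consecutive scales they are even at most
  \<open>1 / (32 * 2 ^ n)\<close>, whereas a window has length at most \<open>24 * 2 ^ n\<close>; so the oscillation on a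
  window is below \<open>1\<close>, as \<open>one_scale_step\<close> demands.
\<close>

lemma multiscale_gain:
  fixes F :: "int \<Rightarrow> real" and e :: nat and K :: "nat \<Rightarrow> int set" and lo hi :: "nat \<Rightarrow> int \<Rightarrow> int"
  assumes finN: "finite N" and finK: "\<And>n. n \<in> N \<Longrightarrow> finite (K n)"
    and scales: "\<And>n n'. n \<in> N \<Longrightarrow> n' \<in> N \<Longrightarrow> n < n' \<Longrightarrow> n + e + 4 \<le> n'"
    and blocks: "\<And>n k k'. n \<in> N \<Longrightarrow> k \<in> K n \<Longrightarrow> k' \<in> K n \<Longrightarrow> k < k' \<Longrightarrow> k + 128 \<le> k'"
    and win: "\<And>n k. n \<in> N \<Longrightarrow> k \<in> K n \<Longrightarrow> (k - 48) * 2 ^ n \<le> 4 * lo n k \<and> 4 * hi n k \<le> (k + 48) * 2 ^ n"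
    and up: "\<And>n k. n \<in> N \<Longrightarrow> k \<in> K n \<Longrightarrow> test_gain F (lo n k) (hi n k) (2 ^ e / 2 ^ (n + 1)) (X n k)"
    and down: "\<And>n k. n \<in> N \<Longrightarrow> k \<in> K n \<Longrightarrow> test_gain (\<lambda>x. - F x) (lo n k) (hi n k) (2 ^ e / 2 ^ (n + 1)) (X n k)"
    and V: "\<And>A. finite A \<Longrightarrow> (\<Sum>x\<in>A. \<bar>F (x + 1) - F x\<bar>) \<le> V"
  shows "(\<Sum>n\<in>N. \<Sum>k\<in>K n. X n k) \<le> 2 * V"
proof -
  have "\<exists>L0. \<forall>n\<in>N. \<forall>k\<in>K n. L0 \<le> lo n k"
  proof -
    have "finite (\<Union>n\<in>N. lo n ` K n)" using finN finK by auto
    then obtain L where "\<forall>y\<in>(\<Union>n\<in>N. lo n ` K n). L \<le> y"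
      by (meson bdd_below_finite bdd_below.E)
    then show ?thesis by auto
  qed
  then obtain L0 where L0: "\<And>n k. n \<in> N \<Longrightarrow> k \<in> K n \<Longrightarrow> L0 \<le> lo n k" by blast
  have "\<exists>H0. \<forall>n\<in>N. \<forall>k\<in>K n. hi n k \<le> H0"
  proof -
    have "finite (\<Union>n\<in>N. hi n ` K n)" using finN finK by auto
    then obtain L where "\<forall>y\<in>(\<Union>n\<in>N. hi n ` K n). y \<le> L"
      by (meson bdd_above_finite bdd_above.E)
    then show ?thesis by auto
  qed
  then obtain H0 where H0: "\<And>n k. n \<in> N \<Longrightarrow> k \<in> K n \<Longrightarrow> hi n k \<le> H0" by blast
  have "M \<subseteq> N \<Longrightarrow> \<exists>g. (\<forall>x. \<bar>g x\<bar> \<le> 1) \<and> (\<forall>m. (\<forall>n\<in>M. m \<le> n) \<longrightarrow> (\<forall>x. \<bar>g (x + 1) - g x\<bar> \<le> 2 ^ e / 2 ^ (m + 1))) \<and>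
      (\<Sum>n\<in>M. \<Sum>k\<in>K n. X n k) / 2 \<le> (\<Sum>x\<in>{L0..<H0}. g x * (F (x + 1) - F x))"
    if "finite M" for M
    using that
  proof (induction M rule: finite_linorder_min_induct)
    case empty
    then show ?case by (intro exI[of _ "\<lambda>_. 0"]) auto
  next
    case (insert n A)
    then have n: "n \<in> N" and AN: "A \<subseteq> N" by auto
    obtain g where g: "\<And>x. \<bar>g x\<bar> \<le> 1"
      "\<And>m x. (\<forall>n\<in>A. m \<le> n) \<Longrightarrow> \<bar>g (x + 1) - g x\<bar> \<le> 2 ^ e / 2 ^ (m + 1)"
      "(\<Sum>n\<in>A. \<Sum>k\<in>K n. X n k) / 2 \<le> (\<Sum>x\<in>{L0..<H0}. g x * (F (x + 1) - F x))"
      using insert.IH[OF AN] by blast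
    have far: "\<forall>n'\<in>A. n + e + 4 \<le> n'" using scales[OF n] AN insert.hyps(2) by blast
    have st: "\<bar>g (x + 1) - g x\<bar> \<le> 1 / (32 * 2 ^ n)" for x
      using g(2)[OF far, of x] by (simp add: power_add)
    have osc: "g x - g y \<le> 1" if k: "k \<in> K n" "x \<in> {lo n k..<hi n k}" "y \<in> {lo n k..<hi n k}" for k x y
    proof -
      have "4 * \<bar>x - y\<bar> \<le> 96 * 2 ^ n" using k(2,3) win[OF n k(1)] by (auto simp: algebra_simps abs_le_iff)
      then have "\<bar>x - y\<bar> \<le> 24 * 2 ^ n" by simp
      then have "real_of_int \<bar>x - y\<bar> \<le> real_of_int (24 * 2 ^ n)"
        by (simp only: of_int_le_iff)
      then have 1: "\<bar>real_of_int (x - y)\<bar> \<le> 24 * 2 ^ n"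
        by simp
      have "\<bar>g x - g y\<bar> \<le> 1 / (32 * 2 ^ n) * \<bar>real_of_int (x - y)\<bar>"
        by (rule increments_le_distance) (rule st)
      also have "\<dots> \<le> 1 / (32 * 2 ^ n) * (24 * 2 ^ n)"
        using 1 by (intro mult_left_mono) auto
      also have "\<dots> \<le> 1" by simp
      finally show ?thesis by linarith
    qed
    have sep: "hi n k < lo n k' \<or> hi n k' < lo n k" if k: "k \<in> K n" "k' \<in> K n" "k \<noteq> k'" for k k'
    proof -
      have *: "hi n k < lo n k'" if k: "k \<in> K n" "k' \<in> K n" "k < k'" for k k'
      proof -
        have "(k + 48) * 2 ^ n < (k' - 48) * (2::int) ^ n" using blocks[OF n k] by simp
        then show ?thesis using win[OF n k(1)] win[OF n k(2)] by linarith
      qed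
      show ?thesis using *[of k k'] *[of k' k] k by linarith
    qed
    have "\<exists>g'. (\<forall>x. \<bar>g' x\<bar> \<le> 1) \<and>
        (\<forall>x. \<bar>g' (x + 1) - g' x\<bar> \<le> \<bar>g (x + 1) - g x\<bar> + 2 ^ e / 2 ^ (n + 1) / 2) \<and>
        (\<Sum>x\<in>{L0..<H0}. g' x * (F (x + 1) - F x)) \<ge>
        (\<Sum>x\<in>{L0..<H0}. g x * (F (x + 1) - F x)) + (\<Sum>k\<in>K n. X n k) / 2"
      by (rule one_scale_step[OF finK[OF n] _ g(1) osc sep up[OF n] down[OF n]])
         (use L0[OF n] H0[OF n] in auto)
    then obtain g' where g': "\<And>x. \<bar>g' x\<bar> \<le> 1"
      "\<And>x. \<bar>g' (x + 1) - g' x\<bar> \<le> \<bar>g (x + 1) - g x\<bar> + 2 ^ e / 2 ^ (n + 1) / 2"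
      "(\<Sum>x\<in>{L0..<H0}. g' x * (F (x + 1) - F x)) \<ge>
        (\<Sum>x\<in>{L0..<H0}. g x * (F (x + 1) - F x)) + (\<Sum>k\<in>K n. X n k) / 2"
      by blast
    have "\<bar>g' (x + 1) - g' x\<bar> \<le> 2 ^ e / 2 ^ (m + 1)" if m: "\<forall>n'\<in>insert n A. m \<le> n'" for m x
    proof -
      have "\<bar>g (x + 1) - g x\<bar> \<le> 2 ^ e / 2 ^ (Suc n + 1)"
        using far by (intro g(2)) auto
      then have "\<bar>g' (x + 1) - g' x\<bar> \<le> 2 ^ e / 2 ^ (n + 1)"
        using g'(2)[of x] by simp
      also have "\<dots> \<le> 2 ^ e / 2 ^ (m + 1)"
        using m by (intro divide_left_mono power_increasing) auto
      finally show ?thesis .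
    qed
    moreover have "(\<Sum>n\<in>insert n A. \<Sum>k\<in>K n. X n k) / 2 \<le> (\<Sum>x\<in>{L0..<H0}. g' x * (F (x + 1) - F x))"
    proof -
      have "n \<notin> A" using insert.hyps by auto
      then show ?thesis using g'(3) g(3) insert.hyps(1) by (simp add: add_divide_distrib)
    qed
    ultimately show ?case using g'(1) by blast
  qed
  from this[OF finN subset_refl] obtain g where g: "\<And>x. \<bar>g x\<bar> \<le> 1"
      "(\<Sum>n\<in>N. \<Sum>k\<in>K n. X n k) / 2 \<le> (\<Sum>x\<in>{L0..<H0}. g x * (F (x + 1) - F x))" by blast
  have "(\<Sum>x\<in>{L0..<H0}. g x * (F (x + 1) - F x)) \<le> (\<Sum>x\<in>{L0..<H0}. \<bar>F (x + 1) - F x\<bar>)"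
  proof (rule sum_mono)
    fix x
    have "g x * (F (x + 1) - F x) \<le> \<bar>g x\<bar> * \<bar>F (x + 1) - F x\<bar>" by (metis abs_ge_self abs_mult)
    also have "\<dots> \<le> 1 * \<bar>F (x + 1) - F x\<bar>" by (intro mult_right_mono g) auto
    finally show "g x * (F (x + 1) - F x) \<le> \<bar>F (x + 1) - F x\<bar>" by simp
  qed
  also have "\<dots> \<le> V" by (intro V) auto
  finally show ?thesis using g(2) by linarith
qed

section \<open>Monotone chains of jumps\<close>

text \<open>
  Let \<open>h r\<close> be the largest weight of a chain with nonincreasing \<open>\<omega>\<close> ending in \<open>r\<close>. If \<open>r < s\<close> and
  \<open>\<omega> s \<le> \<omega> r\<close>, then the intervals \<open>{h r - w r..<h r}\<close> and \<open>{h s - w s..<h s}\<close> are disjoint. So the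
  points whose interval contains a given \<open>t\<close> form a chain with nondecreasing \<open>\<omega>\<close>, of weight at most
  \<open>V\<close>. Integrating over \<open>t\<close>, which ranges over an interval of length \<open>U\<close>, gives the claim, because
  the interval of \<open>r\<close> has length \<open>w r\<close>.
\<close>

lemma weighted_Erdos_Szekeres:
  fixes I :: "int set" and \<omega> :: "int \<Rightarrow> nat" and w :: "int \<Rightarrow> real"
  assumes fin: "finite I" and w: "\<And>r. r \<in> I \<Longrightarrow> 0 \<le> w r"
    and U: "\<And>S. S \<subseteq> I \<Longrightarrow> (\<And>r s. r \<in> S \<Longrightarrow> s \<in> S \<Longrightarrow> r < s \<Longrightarrow> \<omega> s \<le> \<omega> r) \<Longrightarrow> sum w S \<le> U"
    and V: "\<And>S. S \<subseteq> I \<Longrightarrow> (\<And>r s. r \<in> S \<Longrightarrow> s \<in> S \<Longrightarrow> r < s \<Longrightarrow> \<omega> r \<le> \<omega> s) \<Longrightarrow> sum w S \<le> V"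
  shows "(\<Sum>r\<in>I. (w r)\<^sup>2) \<le> U * V"
proof -
  define C where "C r = {S. S \<subseteq> {s\<in>I. s \<le> r} \<and> r \<in> S \<and> (\<forall>x\<in>S. \<forall>y\<in>S. x < y \<longrightarrow> \<omega> y \<le> \<omega> x)}" for r
  define h where "h r = Max (sum w ` C r)" for r
  have finC: "finite (C r)" for r
    by (rule finite_subset[of _ "Pow I"]) (use fin in \<open>auto simp: C_def\<close>)
  have hge: "sum w S \<le> h r" if "S \<in> C r" for S r
    unfolding h_def using finC that by (intro Max_ge) auto
  have single: "{r} \<in> C r" if "r \<in> I" for r using that by (auto simp: C_def)
  have hex: "\<exists>S\<in>C r. h r = sum w S" if "r \<in> I" for r
  proof -
    have "h r \<in> sum w ` C r" unfolding h_def
      using finC single[OF that] by (intro Max_in) auto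
    then show ?thesis by auto
  qed
  have hw: "w r \<le> h r" if "r \<in> I" for r using hge[OF single[OF that]] by simp
  have hU: "h r \<le> U" if r: "r \<in> I" for r
  proof -
    obtain S where S: "S \<in> C r" "h r = sum w S" using hex[OF r] by blast
    have "sum w S \<le> U" by (rule U) (use S(1) in \<open>auto simp: C_def\<close>)
    then show ?thesis using S by simp
  qed
  have step: "h r + w s \<le> h s" if rs: "r \<in> I" "s \<in> I" "r < s" "\<omega> s \<le> \<omega> r" for r s
  proof -
    obtain S where S: "S \<in> C r" "h r = sum w S" using hex[OF rs(1)] by blast
    have le: "x \<le> r" if "x \<in> S" for x using S(1) that by (auto simp: C_def)
    have om: "\<omega> s \<le> \<omega> x" if "x \<in> S" for x
      using S(1) that le[OF that] rs(4) by (cases "x = r") (force simp: C_def)+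
    have "insert s S \<in> C s"
      using S(1) rs om le by (fastforce simp: C_def)
    moreover have "s \<notin> S" using le rs(3) by force
    moreover have "finite S" using S(1) fin by (auto simp: C_def intro: finite_subset)
    ultimately show ?thesis using hge[of "insert s S" s] S(2) by simp
  qed
  define G where "G t = (\<Sum>r\<in>I. w r * indicat_real {h r - w r..<h r} t)" for t
  have V0: "0 \<le> V" using V[of "{}"] by simp
  have U0: "0 \<le> U" using U[of "{}"] by simp
  have Gle: "G t \<le> V * indicat_real {0..<U} t" for t
  proof (cases "t \<in> {0..<U}")
    case True
    define A where "A = {r\<in>I. h r - w r \<le> t \<and> t < h r}"
    have "G t = (\<Sum>r\<in>I. if h r - w r \<le> t \<and> t < h r then w r else 0)"
      unfolding G_def by (intro sum.cong) (auto simp: indicator_def)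
    also have "\<dots> = sum w A" unfolding A_def using fin by (simp add: sum.inter_filter)
    also have "\<dots> \<le> V"
    proof (rule V)
      fix r s assume rs: "r \<in> A" "s \<in> A" "r < s"
      then show "\<omega> r \<le> \<omega> s" using step[of r s] by (force simp: A_def)
    qed (auto simp: A_def)
    finally show ?thesis using True by simp
  next
    case False
    have "w r * indicat_real {h r - w r..<h r} t = 0" if "r \<in> I" for r
      using hU[OF that] hw[OF that] False by (auto simp: indicator_def)
    then have "G t = 0" unfolding G_def by (intro sum.neutral) auto
    then show ?thesis using False by simp
  qed
  have int: "integrable lborel (indicat_real {a..<b})" for a b :: real
    by (cases "a \<le> b") (auto simp: integrable_indicator_iff)
  have intG: "integrable lborel G"
    unfolding G_def[abs_def] by (intro Bochner_Integration.integrable_sum integrable_mult_right int)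
  have "(\<Sum>r\<in>I. (w r)\<^sup>2) = (\<Sum>r\<in>I. w r * measure lborel {h r - w r..<h r})"
    by (intro sum.cong) (use w in \<open>auto simp: power2_eq_square\<close>)
  also have "\<dots> = integral\<^sup>L lborel G"
    unfolding G_def by (subst Bochner_Integration.integral_sum) (auto intro!: int)
  also have "\<dots> \<le> integral\<^sup>L lborel (\<lambda>t. V * indicat_real {0..<U} t)"
    by (rule integral_mono) (auto simp: Gle intro!: intG int)
  also have "\<dots> = U * V" using U0 by simp
  finally show ?thesis .
qed

lemma test_gain_descent:
  fixes f :: "int \<Rightarrow> real"
  assumes "lo \<le> s" "s < t" "t \<le> s'" "s' < t'" "t' \<le> hi"
    and c: "1 / real_of_int (t - s) \<le> c" "1 / real_of_int (t' - s') \<le> c"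
    and X: "X \<le> sum f {s..<t} / real_of_int (t - s) - sum f {s'..<t'} / real_of_int (t' - s')"
  shows "test_gain (\<lambda>x. - f x) lo hi c X"
  using assms by (intro test_gain_ascent[of lo s t s' t']) (auto simp: sum_negf)

lemma test_gain_of_means:
  fixes f :: "int \<Rightarrow> real" and a b :: int
  assumes "lo \<le> s" "t \<le> s'" "t' \<le> hi" "t - s = a" "t' - s' = b" "0 < a" "0 < b"
    and c: "1 / real_of_int a \<le> c" "1 / real_of_int b \<le> c"
  shows "sum f {s..<t} / real_of_int a \<le> m \<Longrightarrow> M \<le> sum f {s'..<t'} / real_of_int b \<Longrightarrow>
      X \<le> M - m \<Longrightarrow> test_gain f lo hi c X"
    and "M \<le> sum f {s..<t} / real_of_int a \<Longrightarrow> sum f {s'..<t'} / real_of_int b \<le> m \<Longrightarrow>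
      X \<le> M - m \<Longrightarrow> test_gain (\<lambda>x. - f x) lo hi c X"
proof -
  have st: "s < t" "s' < t'" using assms by auto
  have c': "1 / real_of_int (t - s) \<le> c" "1 / real_of_int (t' - s') \<le> c"
    using c by (simp_all only: assms(4,5))
  show "test_gain f lo hi c X" if "sum f {s..<t} / real_of_int a \<le> m" "M \<le> sum f {s'..<t'} / real_of_int b" "X \<le> M - m"
    by (rule test_gain_ascent[OF assms(1) st(1) assms(2) st(2) assms(3) c'])
       (simp only: assms(4,5), use that in linarith)
  show "test_gain (\<lambda>x. - f x) lo hi c X" if "M \<le> sum f {s..<t} / real_of_int a" "sum f {s'..<t'} / real_of_int b \<le> m" "X \<le> M - m"
    by (rule test_gain_descent[OF assms(1) st(1) assms(2) st(2) assms(3) c'])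
       (simp only: assms(4,5), use that in linarith)
qed

text \<open>
  A succession of upward jumps of \<open>f\<close>, at well separated positions: next to \<open>pos r\<close> the mean of \<open>f\<close>
  is below \<open>lev r\<close> on the left and above it on the right. The levels are allowed to vary. The total
  rise does not depend on them, but an increase of the level between two jumps reduces the fall
  between them; hence the net increase of the level is subtracted from the total fall.
\<close>

locale jump_chain =
  fixes f :: "int \<Rightarrow> real" and S :: "int set" and pos len len' :: "int \<Rightarrow> int"
    and lev jump :: "int \<Rightarrow> real" and L :: int and c :: real
  assumes finS: "finite S"
    and len: "r \<in> S \<Longrightarrow> 0 < len r \<and> len r \<le> L" "r \<in> S \<Longrightarrow> 1 / real_of_int (len r) \<le> c"
    and len': "r \<in> S \<Longrightarrow> 0 < len' r \<and> len' r \<le> L" "r \<in> S \<Longrightarrow> 1 / real_of_int (len' r) \<le> c"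
    and low: "r \<in> S \<Longrightarrow> sum f {pos r - len r..<pos r} / real_of_int (len r) \<le> lev r - jump r"
    and high: "r \<in> S \<Longrightarrow> lev r + jump r \<le> sum f {pos r..<pos r + len' r} / real_of_int (len' r)"
    and apart: "r \<in> S \<Longrightarrow> s \<in> S \<Longrightarrow> r < s \<Longrightarrow> pos r + 2 * L \<le> pos s"
    and c0: "0 \<le> c"
begin

lemma ascents:
  assumes "lo \<le> hi" "\<And>r. r \<in> S \<Longrightarrow> lo \<le> pos r - L \<and> pos r + L \<le> hi"
  shows "test_gain f lo hi c (\<Sum>r\<in>S. 2 * jump r)"
proof -
  have "T \<subseteq> S \<longrightarrow> (\<forall>hi. lo \<le> hi \<longrightarrow> (\<forall>r\<in>T. pos r + L \<le> hi) \<longrightarrow> test_gain f lo hi c (\<Sum>r\<in>T. 2 * jump r))"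
    if "finite T" for T
    using that
  proof (induction T rule: finite_linorder_max_induct)
    case empty
    then show ?case using c0 by (simp add: test_gain_zero)
  next
    case (insert b A)
    show ?case
    proof (intro impI allI)
      fix hi assume sub: "insert b A \<subseteq> S" and hi: "\<forall>r\<in>insert b A. pos r + L \<le> hi"
      have b: "b \<in> S" using sub by auto
      have "test_gain f lo (pos b - L) c (\<Sum>r\<in>A. 2 * jump r)"
      proof -
        have "pos r + L \<le> pos b - L" if "r \<in> A" for r
          using apart[of r b] that sub insert.hyps(2) by force
        then show ?thesis using insert.IH sub assms(2)[OF b] by auto
      qed
      moreover have "test_gain f (pos b - L) hi c (2 * jump b)"
        by (rule test_gain_ascent[of _ "pos b - len b" "pos b" "pos b" "pos b + len' b"])
           (use len[OF b] len'[OF b] low[OF b] high[OF b] hi in auto)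
      ultimately have "test_gain f lo hi c ((\<Sum>r\<in>A. 2 * jump r) + 2 * jump b)"
        by (rule test_gain_append) (use assms(2)[OF b] hi len[OF b] in auto)
      moreover have "b \<notin> A" using insert.hyps by auto
      ultimately show "test_gain f lo hi c (\<Sum>r\<in>insert b A. 2 * jump r)"
        using insert.hyps by (simp add: add.commute)
    qed
  qed
  then show ?thesis using finS assms by blast
qed

lemma descents:
  assumes "S \<noteq> {}" "\<And>r. r \<in> S \<Longrightarrow> lo \<le> pos r \<and> pos r \<le> hi"
  shows "test_gain (\<lambda>x. - f x) lo hi c
    ((\<Sum>r\<in>S. 2 * jump r) - jump (Min S) - jump (Max S) - (lev (Max S) - lev (Min S)))"
proof -
  have "T \<subseteq> S \<longrightarrow> T \<noteq> {} \<longrightarrow> test_gain (\<lambda>x. - f x) lo (pos (Max T)) c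
       ((\<Sum>r\<in>T. 2 * jump r) - jump (Min T) - jump (Max T) - (lev (Max T) - lev (Min T)))"
    if "finite T" for T
    using that
  proof (induction T rule: finite_linorder_max_induct)
    case empty
    then show ?case by simp
  next
    case (insert b A)
    show ?case
    proof (intro impI)
      assume sub: "insert b A \<subseteq> S"
      then have b: "b \<in> S" by auto
      have Mb: "Max (insert b A) = b" using insert.hyps by (intro Max_eqI) (auto intro: less_imp_le)
      have bA: "b \<notin> A" using insert.hyps by auto
      show "test_gain (\<lambda>x. - f x) lo (pos (Max (insert b A))) c
       ((\<Sum>r\<in>insert b A. 2 * jump r) - jump (Min (insert b A)) - jump (Max (insert b A)) -
          (lev (Max (insert b A)) - lev (Min (insert b A))))"
      proof (cases "A = {}")
        case True
        then show ?thesis using c0 by (simp add: test_gain_zero)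
      next
        case False
        define t where "t = Max A"
        have tA: "t \<in> A" using False insert.hyps(1) by (simp add: t_def)
        then have t: "t \<in> S" "t < b" using sub insert.hyps by auto
        have mb: "Min (insert b A) = Min A"
        proof -
          have "Min A < b" using False insert.hyps by simp
          then have "min b (Min A) = Min A" by (simp only: min_def) auto
          then show ?thesis by (simp only: Min_insert[OF insert.hyps(1) False])
        qed
        have IH: "test_gain (\<lambda>x. - f x) lo (pos t) c
          ((\<Sum>r\<in>A. 2 * jump r) - jump (Min A) - jump t - (lev t - lev (Min A)))"
          using insert.IH sub False by (simp add: t_def)
        have "test_gain (\<lambda>x. - f x) (pos t) (pos b) c (lev t + jump t - (lev b - jump b))"
          by (rule test_gain_descent[of _ "pos t" "pos t + len' t" "pos b - len b" "pos b"])
             (use len[OF b] len'[OF t(1)] low[OF b] high[OF t(1)] apart[OF t(1) b t(2)] in auto)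
        from test_gain_append[OF IH this] show ?thesis
          unfolding Mb mb using assms(2)[OF t(1)] apart[OF t(1) b t(2)] len(1)[OF b] bA insert.hyps(1)
          by (simp add: algebra_simps)
      qed
    qed
  qed
  then have "test_gain (\<lambda>x. - f x) lo (pos (Max S)) c
       ((\<Sum>r\<in>S. 2 * jump r) - jump (Min S) - jump (Max S) - (lev (Max S) - lev (Min S)))"
    using finS assms by blast
  then show ?thesis
    by (rule test_gain_mono) (use assms finS Max_in[OF finS] in auto)
qed

end

section \<open>Peaks of a maximal function\<close>

text \<open>
  All that matters about the maximal function \<open>u\<close> is that it is the supremum of the averages over
  centered balls. That supremum need not be attained, hence the second assumption.
\<close>

locale discrete_maximal =
  fixes F u :: "int \<Rightarrow> real" and V :: real
  assumes average_le: "\<And>r w. sum F {r - int w..<r + int w + 1} \<le> (2 * real w + 1) * u r"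
    and nearly_attained: "\<And>c r. c < u r \<Longrightarrow> \<exists>w. (2 * real w + 1) * c < sum F {r - int w..<r + int w + 1}"
    and total_variation: "\<And>A. finite A \<Longrightarrow> (\<Sum>x\<in>A. \<bar>F (x + 1) - F x\<bar>) \<le> V"
begin

lemma F_le_u: "F r \<le> u r"
proof -
  have "{r..<r + 1} = {r}" by auto
  then show ?thesis using average_le[of r 0] by simp
qed

lemma sum_centered_le:
  assumes "a < b" "a + b = 2 * p + 1" "u p \<le> \<mu>"
  shows "sum F {a..<b} \<le> real_of_int (b - a) * \<mu>"
proof -
  define w where "w = nat (p - a)"
  have a: "a = p - int w" and b: "b = p + int w + 1" using assms by (auto simp: w_def)
  have "sum F {a..<b} \<le> (2 * real w + 1) * u p" unfolding a b by (rule average_le)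
  also have "\<dots> \<le> (2 * real w + 1) * \<mu>" using assms by (intro mult_left_mono) auto
  also have "2 * real w + 1 = real_of_int (b - a)" by (simp add: a b)
  finally show ?thesis .
qed

text \<open>
  Let the ball of radius \<open>w\<close> around \<open>r\<close> have an average of at least \<open>\<nu>\<close>. Extending or shrinking it
  at one end by \<open>2 * (r - p)\<close> points gives a ball around \<open>p\<close>, whose average is at most \<open>\<mu>\<close>. So the
  points added have a deficit, and the points removed have a surplus, of \<open>(2 * w + 1) * (\<nu> - \<mu>)\<close>
  relative to \<open>\<mu>\<close>. The same holds for a point \<open>q\<close> on the right of \<open>r\<close>.
\<close>

context
  fixes r :: int and w :: nat and \<mu> \<nu> :: real
  assumes ball: "(2 * real w + 1) * \<nu> \<le> sum F {r - int w..<r + int w + 1}"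
begin

lemma low_left:
  assumes "p < r" "u p \<le> \<mu>"
  shows "sum F {r - int w - 2 * (r - p)..<r - int w} \<le> 2 * real_of_int (r - p) * \<mu> - (2 * real w + 1) * (\<nu> - \<mu>)"
proof -
  have "sum F {r - int w - 2 * (r - p)..<r + int w + 1} \<le> real_of_int (r + int w + 1 - (r - int w - 2 * (r - p))) * \<mu>"
    by (rule sum_centered_le[of _ _ p]) (use assms in auto)
  then show ?thesis using ball assms
      sum_int_ivl_split[of "r - int w - 2 * (r - p)" "r - int w" "r + int w + 1" F]
    by (simp add: algebra_simps)
qed

lemma low_right:
  assumes "r < q" "u q \<le> \<mu>"
  shows "sum F {r + int w + 1..<r + int w + 1 + 2 * (q - r)} \<le> 2 * real_of_int (q - r) * \<mu> - (2 * real w + 1) * (\<nu> - \<mu>)"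
proof -
  have "sum F {r - int w..<r + int w + 1 + 2 * (q - r)} \<le> real_of_int (r + int w + 1 + 2 * (q - r) - (r - int w)) * \<mu>"
    by (rule sum_centered_le[of _ _ q]) (use assms in auto)
  then show ?thesis using ball assms
      sum_int_ivl_split[of "r - int w" "r + int w + 1" "r + int w + 1 + 2 * (q - r)" F]
    by (simp add: algebra_simps)
qed

lemma high_right:
  assumes "p < r" "u p \<le> \<mu>" "r - p \<le> int w"
  shows "2 * real_of_int (r - p) * \<mu> + (2 * real w + 1) * (\<nu> - \<mu>) \<le> sum F {r + int w + 1 - 2 * (r - p)..<r + int w + 1}"
proof -
  have "sum F {r - int w..<r + int w + 1 - 2 * (r - p)} \<le> real_of_int (r + int w + 1 - 2 * (r - p) - (r - int w)) * \<mu>"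
    by (rule sum_centered_le[of _ _ p]) (use assms in auto)
  then show ?thesis using ball assms
      sum_int_ivl_split[of "r - int w" "r + int w + 1 - 2 * (r - p)" "r + int w + 1" F]
    by (simp add: algebra_simps)
qed

lemma high_left:
  assumes "r < q" "u q \<le> \<mu>" "q - r \<le> int w"
  shows "2 * real_of_int (q - r) * \<mu> + (2 * real w + 1) * (\<nu> - \<mu>) \<le> sum F {r - int w..<r - int w + 2 * (q - r)}"
proof -
  have "sum F {r - int w + 2 * (q - r)..<r + int w + 1} \<le> real_of_int (r + int w + 1 - (r - int w + 2 * (q - r))) * \<mu>"
    by (rule sum_centered_le[of _ _ q]) (use assms in auto)
  then show ?thesis using ball assms
      sum_int_ivl_split[of "r - int w" "r - int w + 2 * (q - r)" "r + int w + 1" F]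
    by (simp add: algebra_simps)
qed

end

text \<open>
  The distances from \<open>r\<close> to \<open>p\<close> and to \<open>q\<close> are both comparable to \<open>2 ^ j\<close>. The condition on \<open>F\<close>
  expresses that the height of \<open>u\<close> at \<open>r\<close> is not inherited from a nearby large value of \<open>F\<close>; it
  forces the radius \<open>w\<close> to be large.
\<close>

definition peak :: "nat \<Rightarrow> int \<Rightarrow> int \<Rightarrow> int \<Rightarrow> nat \<Rightarrow> real \<Rightarrow> real \<Rightarrow> bool" where
  "peak j p r q w l D \<longleftrightarrow> p < r \<and> r < q \<and> 2 ^ j \<le> 2 * (r - p) \<and> 2 ^ j \<le> 2 * (q - r) \<and> q - p < 2 ^ (j + 1) \<and>
     0 < D \<and> u p \<le> l \<and> u q \<le> l \<and> (\<forall>x. p < x \<and> x < q \<longrightarrow> F x \<le> l) \<and>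
     (2 * real w + 1) * (l + D) \<le> sum F {r - int w..<r + int w + 1}"

text \<open>
  If the ball around \<open>r\<close> stayed inside the peak, its average would be at most \<open>l\<close>. If it left the
  peak at the left end only, it would split into a ball around \<open>p\<close> and a part inside the peak, and
  both have averages at most \<open>l\<close>.
\<close>

lemma peak_radius:
  assumes "peak j p r q w l D"
  shows "r - p \<le> int w" "q - r \<le> int w"
proof -
  have P: "p < r" "r < q" "0 < D" "u p \<le> l" "u q \<le> l" "\<And>x. p < x \<Longrightarrow> x < q \<Longrightarrow> F x \<le> l"
    "(2 * real w + 1) * (l + D) \<le> sum F {r - int w..<r + int w + 1}"
    using assms unfolding peak_def by auto
  have small: "sum F {s..<t} \<le> real_of_int (t - s) * l" if "s \<le> t" "p < s" "t \<le> q" for s t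
    using sum_bounded_above[of "{s..<t}" F l] P(6) that by simp
  have big: "real_of_int (r + int w + 1 - (r - int w)) * l < sum F {r - int w..<r + int w + 1}"
  proof -
    have "0 < (2 * real w + 1) * D" using P(3) by simp
    then have "(2 * real w + 1) * l < (2 * real w + 1) * (l + D)" by (simp only: distrib_left)
    also note P(7)
    finally show ?thesis by simp
  qed
  have "r - int w \<le> p \<and> q \<le> r + int w"
  proof (rule ccontr)
    assume "\<not> ?thesis"
    then consider "p < r - int w" "r + int w < q" | "r - int w \<le> p" "r + int w < q" | "p < r - int w" "q \<le> r + int w"
      by linarith
    then show False
    proof cases
      case 1
      then show False using small[of "r - int w" "r + int w + 1"] big by simp
    next
      case 2
      let ?c = "2 * p + 1 - (r - int w)"
      have "sum F {r - int w..<?c} \<le> real_of_int (?c - (r - int w)) * l"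
        by (rule sum_centered_le[of _ _ p]) (use 2 P in auto)
      moreover have "sum F {?c..<r + int w + 1} \<le> real_of_int (r + int w + 1 - ?c) * l"
        by (rule small) (use 2 P in auto)
      ultimately show False using big sum_int_ivl_split[of "r - int w" ?c "r + int w + 1" F] 2 P
        by (simp add: algebra_simps)
    next
      case 3
      let ?c = "2 * q + 1 - (r + int w + 1)"
      have "sum F {?c..<r + int w + 1} \<le> real_of_int (r + int w + 1 - ?c) * l"
        by (rule sum_centered_le[of _ _ q]) (use 3 P in auto)
      moreover have "sum F {r - int w..<?c} \<le> real_of_int (?c - (r - int w)) * l"
        by (rule small) (use 3 P in auto)
      ultimately show False using big sum_int_ivl_split[of "r - int w" ?c "r + int w + 1" F] 3 P
        by (simp add: algebra_simps)
    qed
  qed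
  then show "r - p \<le> int w" "q - r \<le> int w" by auto
qed

end

lemma mean_le_of_deficit:
  fixes m L :: real and d :: int
  assumes "sum F I \<le> 2 * real_of_int d * \<mu> - m" "0 < d" "real_of_int (2 * d) \<le> L" "0 \<le> m"
  shows "sum F I / real_of_int (2 * d) \<le> \<mu> - m / L"
proof -
  have "sum F I / real_of_int (2 * d) \<le> (2 * real_of_int d * \<mu> - m) / real_of_int (2 * d)"
    using assms by (intro divide_right_mono) auto
  also have "\<dots> = \<mu> - m / real_of_int (2 * d)" using assms(2) by (simp add: diff_divide_distrib)
  also have "\<dots> \<le> \<mu> - m / L" using assms by (simp add: divide_left_mono)
  finally show ?thesis .
qed

lemma mean_ge_of_surplus:
  fixes m L :: real and d :: int
  assumes "2 * real_of_int d * \<mu> + m \<le> sum F I" "0 < d" "real_of_int (2 * d) \<le> L" "0 \<le> m"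
  shows "\<mu> + m / L \<le> sum F I / real_of_int (2 * d)"
proof -
  have "\<mu> + m / L \<le> \<mu> + m / real_of_int (2 * d)" using assms by (simp add: divide_left_mono)
  also have "\<dots> = (2 * real_of_int d * \<mu> + m) / real_of_int (2 * d)" using assms(2) by (simp add: add_divide_distrib)
  also have "\<dots> \<le> sum F I / real_of_int (2 * d)" using assms by (intro divide_right_mono) auto
  finally show ?thesis .
qed

lemma inverse_le_of_power_le: "1 / real_of_int a \<le> 1 / 2 ^ j" if "2 ^ j \<le> a" for a :: int
proof -
  have "(2::real) ^ j \<le> real_of_int a"
    using that by (metis of_int_le_iff of_int_numeral of_int_power)
  then show ?thesis by (intro frac_le) auto
qed

text \<open>
  This is the gain from comparing two peaks whose distance is small relative to their radius: a
  difference of levels \<open>R\<close> turns into a difference of means of at least \<open>2 * R\<close>.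
\<close>

lemma double_rise_le_mean:
  assumes "4 * d \<le> 2 * int w + 1" "0 < d" "0 \<le> R" "R \<le> X"
  shows "2 * R \<le> (2 * real w + 1) * X / (2 * real_of_int d)"
proof -
  have "real_of_int (4 * d) \<le> real_of_int (2 * int w + 1)" using assms(1) by (simp only: of_int_le_iff)
  then have a: "4 * real_of_int d \<le> 2 * real w + 1" by simp
  have "4 * real_of_int d * R \<le> (2 * real w + 1) * X" using assms by (intro mult_mono a) auto
  then show ?thesis using assms(2) by (simp add: field_simps)
qed

text \<open>
  Peaks of one width \<open>2 ^ j\<close>, indexed by their centers, which are well separated relative to the
  width but close to each other relative to the radii.
\<close>

locale peak_chain = discrete_maximal +
  fixes S :: "int set" and j :: nat and p q :: "int \<Rightarrow> int" and w :: "int \<Rightarrow> nat" and l D :: "int \<Rightarrow> real"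
    and lo hi :: int
  assumes finS: "finite S" and ne: "S \<noteq> {}"
    and peaks: "\<And>r. r \<in> S \<Longrightarrow> peak j (p r) r (q r) (w r) (l r) (D r)"
    and spaced: "\<And>r s. r \<in> S \<Longrightarrow> s \<in> S \<Longrightarrow> r < s \<Longrightarrow> r + 8 * 2 ^ j \<le> s"
    and near: "\<And>r s. r \<in> S \<Longrightarrow> s \<in> S \<Longrightarrow> 4 * \<bar>s - r\<bar> \<le> int (w r)"
    and window: "\<And>r. r \<in> S \<Longrightarrow> lo \<le> r - int (w r) - 2 ^ (j + 2) \<and> r + int (w r) + 1 + 2 ^ (j + 2) \<le> hi"
begin

definition jump :: "int \<Rightarrow> real" where
  "jump r = (2 * real (w r) + 1) * D r / 2 ^ (j + 2)"

context
  fixes r assumes r: "r \<in> S"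
begin

lemma sides:
  "p r < r" "r < q r" "2 ^ j \<le> 2 * (r - p r)" "2 ^ j \<le> 2 * (q r - r)"
  "2 * (r - p r) \<le> 2 ^ (j + 2)" "2 * (q r - r) \<le> 2 ^ (j + 2)" "0 < D r" "u (p r) \<le> l r" "u (q r) \<le> l r"
  "(2 * real (w r) + 1) * (l r + D r) \<le> sum F {r - int (w r)..<r + int (w r) + 1}"
  "r - p r \<le> int (w r)" "q r - r \<le> int (w r)" "0 \<le> jump r"
  using peaks[OF r] peak_radius[OF peaks[OF r]] unfolding peak_def jump_def by auto

lemma real_sides:
  "real_of_int (2 * (r - p r)) \<le> 2 ^ (j + 2)" "real_of_int (2 * (q r - r)) \<le> 2 ^ (j + 2)"
  "1 / real_of_int (2 * (r - p r)) \<le> 1 / 2 ^ j" "1 / real_of_int (2 * (q r - r)) \<le> 1 / 2 ^ j"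
proof -
  have *: "real_of_int a \<le> 2 ^ i" if "a \<le> 2 ^ i" for a i
    using that by (metis of_int_le_iff of_int_numeral of_int_power)
  show "real_of_int (2 * (r - p r)) \<le> 2 ^ (j + 2)" "real_of_int (2 * (q r - r)) \<le> 2 ^ (j + 2)"
    "1 / real_of_int (2 * (r - p r)) \<le> 1 / 2 ^ j" "1 / real_of_int (2 * (q r - r)) \<le> 1 / 2 ^ j"
    using *[OF sides(5)] *[OF sides(6)] inverse_le_of_power_le[OF sides(3)] inverse_le_of_power_le[OF sides(4)]
    by auto
qed

lemma mean_bounds:
  "sum F {r - int (w r) - 2 * (r - p r)..<r - int (w r)} / real_of_int (2 * (r - p r)) \<le> l r - jump r"
  "l r + jump r \<le> sum F {r - int (w r)..<r - int (w r) + 2 * (q r - r)} / real_of_int (2 * (q r - r))"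
  "l r + jump r \<le> sum F {r + int (w r) + 1 - 2 * (r - p r)..<r + int (w r) + 1} / real_of_int (2 * (r - p r))"
  "sum F {r + int (w r) + 1..<r + int (w r) + 1 + 2 * (q r - r)} / real_of_int (2 * (q r - r)) \<le> l r - jump r"
proof -
  have m: "0 \<le> (2 * real (w r) + 1) * D r" using sides(7) by simp
  show "sum F {r - int (w r) - 2 * (r - p r)..<r - int (w r)} / real_of_int (2 * (r - p r)) \<le> l r - jump r"
    unfolding jump_def
    by (rule mean_le_of_deficit) (use low_left[OF sides(10) sides(1) sides(8)] sides(1) real_sides(1) m in auto)
  show "sum F {r + int (w r) + 1..<r + int (w r) + 1 + 2 * (q r - r)} / real_of_int (2 * (q r - r)) \<le> l r - jump r"
    unfolding jump_def
    by (rule mean_le_of_deficit) (use low_right[OF sides(10) sides(2) sides(9)] sides(2) real_sides(2) m in auto)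
  show "l r + jump r \<le> sum F {r - int (w r)..<r - int (w r) + 2 * (q r - r)} / real_of_int (2 * (q r - r))"
    unfolding jump_def
    by (rule mean_ge_of_surplus) (use high_left[OF sides(10) sides(2) sides(9) sides(12)] sides(2) real_sides(2) m in auto)
  show "l r + jump r \<le> sum F {r + int (w r) + 1 - 2 * (r - p r)..<r + int (w r) + 1} / real_of_int (2 * (r - p r))"
    unfolding jump_def
    by (rule mean_ge_of_surplus) (use high_right[OF sides(10) sides(1) sides(8) sides(11)] sides(1) real_sides(1) m in auto)
qed

end

lemma inside:
  assumes "r \<in> S"
  shows "lo \<le> r - int (w r) \<and> r - int (w r) \<le> hi" "lo \<le> r + int (w r) + 1 \<and> r + int (w r) + 1 \<le> hi"
proof -
  have "(0::int) \<le> 2 ^ (j + 2)" by simp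
  then show "lo \<le> r - int (w r) \<and> r - int (w r) \<le> hi" "lo \<le> r + int (w r) + 1 \<and> r + int (w r) + 1 \<le> hi"
    using window[OF assms] by linarith+
qed

lemma lo_le_hi: "lo \<le> hi"
  using ne inside by fastforce

lemma two_jumps_le:
  assumes "s \<in> S" "t \<in> S" "s \<noteq> t"
  shows "jump s + jump t \<le> sum jump S"
proof -
  have "sum jump {s, t} \<le> sum jump S"
    by (rule sum_mono2) (use assms finS sides(13) in auto)
  then show ?thesis using assms by simp
qed

text \<open>
  If the radii do not increase, then the left ends \<open>r - w r\<close> of the balls advance at least as fast
  as the centers, so the upward jumps at the left ends form a \<open>jump_chain\<close>. This settles the rises,
  and also the falls unless the levels increase by a large amount \<open>R\<close> from the first peak \<open>s\<close> to
  the last peak \<open>t\<close>. In the latter case a single fall suffices: comparing the ball around \<open>t\<close> with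
  the foot \<open>p s\<close> of the first peak shows that the mean of \<open>F\<close> exceeds the level of \<open>s\<close> by \<open>2 * R\<close>
  on an interval at the right end of the ball around \<open>t\<close>, and just behind that end the mean is
  below the level of \<open>t\<close>.
\<close>

lemma gain_decreasing_radii:
  assumes mono: "\<And>r s. r \<in> S \<Longrightarrow> s \<in> S \<Longrightarrow> r < s \<Longrightarrow> w s \<le> w r"
  shows "test_gain F lo hi (1 / 2 ^ j) (sum jump S / 2)"
    and "test_gain (\<lambda>x. - F x) lo hi (1 / 2 ^ j) (sum jump S / 2)"
proof -
  interpret jump_chain F S "\<lambda>r. r - int (w r)" "\<lambda>r. 2 * (r - p r)" "\<lambda>r. 2 * (q r - r)" l jump "2 ^ (j + 2)" "1 / 2 ^ j"
  proof unfold_locales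
    fix r s assume rs: "r \<in> S" "s \<in> S" "r < s"
    then show "r - int (w r) + 2 * 2 ^ (j + 2) \<le> s - int (w s)"
      using spaced[OF rs] mono[OF rs] by simp
  qed (use finS sides real_sides mean_bounds in auto)
  have nn: "0 \<le> sum jump S" using sides(13) by (intro sum_nonneg) auto
  have "test_gain F lo hi (1 / 2 ^ j) (\<Sum>r\<in>S. 2 * jump r)"
    by (rule ascents) (use lo_le_hi window in force)+
  then show "test_gain F lo hi (1 / 2 ^ j) (sum jump S / 2)"
    by (rule test_gain_mono) (use nn in \<open>auto simp flip: sum_distrib_left\<close>)
  define s t where "s = Min S" and "t = Max S"
  have s: "s \<in> S" and t: "t \<in> S" using finS ne by (auto simp: s_def t_def)
  show "test_gain (\<lambda>x. - F x) lo hi (1 / 2 ^ j) (sum jump S / 2)"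
  proof (cases "s = t")
    case True
    then have "S \<subseteq> {t}" using finS by (auto simp: s_def t_def intro!: antisym Max_ge) (metis Min_le)
    then have "S = {t}" using t by blast
    then have "sum jump S = jump t" by simp
    then have "sum jump S / 2 \<le> (l t + jump t) - (l t - jump t)" using sides(13)[OF t] by simp
    moreover have "2 * (t - p t) \<le> 2 * int (w t)" using sides(11)[OF t] by simp
    ultimately show ?thesis
      using sides(1,2,6)[OF t] window[OF t]
      by (intro test_gain_of_means(2)[OF _ order_refl _ _ _ _ _ real_sides(3,4)[OF t] mean_bounds(3,4)[OF t]]) auto
  next
    case False
    then have st: "s < t" using finS s by (simp add: s_def t_def order_less_le)
    show ?thesis
    proof (cases "l t - l s \<le> sum jump S / 2")
      case True
      have "test_gain (\<lambda>x. - F x) lo hi (1 / 2 ^ j) ((\<Sum>r\<in>S. 2 * jump r) - jump s - jump t - (l t - l s))"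
        unfolding s_def t_def by (rule descents[OF ne]) (rule inside)
      then show ?thesis
        by (rule test_gain_mono)
           (use True two_jumps_le[OF s t False] in \<open>auto simp flip: sum_distrib_left\<close>)
    next
      case False
      \<comment> \<open>The foot of the first peak is a test point for the ball around the last one.\<close>
      define d where "d = t - p s"
      have "2 ^ j \<le> 2 * d" using sides(1,3)[OF s] st by (simp add: d_def)
      moreover have "4 * (s - p s) \<le> t - s" using sides(5)[OF s] spaced[OF s t st] by simp
      ultimately have d: "0 < d" "4 * d \<le> 2 * int (w t) + 1" "d \<le> int (w t)" "2 ^ j \<le> 2 * d" "p s < t"
        using sides(1)[OF s] st near[OF t s] unfolding d_def by auto
      define m where "m = (2 * real (w t) + 1) * (l t + D t - l s)"
      have R: "0 < l t - l s" using False nn by simp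
      have "2 * (l t - l s) \<le> m / (2 * real_of_int d)"
        unfolding m_def by (rule double_rise_le_mean) (use d R sides(7)[OF t] in auto)
      moreover have "l s + m / real_of_int (2 * d) \<le>
          sum F {t + int (w t) + 1 - 2 * d..<t + int (w t) + 1} / real_of_int (2 * d)"
        using high_right[OF sides(10)[OF t] d(5) sides(8)[OF s]] d(1,3) R sides(7)[OF t]
        by (intro mean_ge_of_surplus) (auto simp: d_def m_def)
      ultimately have *: "l s + 2 * (l t - l s) \<le>
          sum F {t + int (w t) + 1 - 2 * d..<t + int (w t) + 1} / real_of_int (2 * d)" by simp
      have "sum jump S / 2 \<le> (l s + 2 * (l t - l s)) - (l t - jump t)"
        using False sides(13)[OF t] by simp
      then show ?thesis
        using sides(1,2,6)[OF t] window[OF t] d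
        by (intro test_gain_of_means(2)[OF _ order_refl _ _ _ _ _ inverse_le_of_power_le[OF d(4)] real_sides(4)[OF t] *
              mean_bounds(4)[OF t]]) auto
    qed
  qed
qed

text \<open>
  This is the mirror image of the preceding lemma, with the downward jumps at the right ends of the
  balls and, if the levels decrease too much, the foot \<open>q t\<close> of the last peak and the ball around
  the first.
\<close>

lemma gain_increasing_radii:
  assumes mono: "\<And>r s. r \<in> S \<Longrightarrow> s \<in> S \<Longrightarrow> r < s \<Longrightarrow> w r \<le> w s"
  shows "test_gain F lo hi (1 / 2 ^ j) (sum jump S / 2)"
    and "test_gain (\<lambda>x. - F x) lo hi (1 / 2 ^ j) (sum jump S / 2)"
proof -
  interpret jump_chain "\<lambda>x. - F x" S "\<lambda>r. r + int (w r) + 1" "\<lambda>r. 2 * (r - p r)" "\<lambda>r. 2 * (q r - r)"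
    "\<lambda>r. - l r" jump "2 ^ (j + 2)" "1 / 2 ^ j"
  proof unfold_locales
    fix r assume r: "r \<in> S"
    show "(\<Sum>x = r + int (w r) + 1 - 2 * (r - p r)..<r + int (w r) + 1. - F x) / real_of_int (2 * (r - p r)) \<le> - l r - jump r"
      "- l r + jump r \<le> (\<Sum>x = r + int (w r) + 1..<r + int (w r) + 1 + 2 * (q r - r). - F x) / real_of_int (2 * (q r - r))"
      using mean_bounds(3,4)[OF r] by (simp_all only: sum_negf minus_divide_left[symmetric])
    fix s assume rs: "s \<in> S" "r < s"
    then show "r + int (w r) + 1 + 2 * 2 ^ (j + 2) \<le> s + int (w s) + 1"
      using spaced[OF r rs] mono[OF r rs] by simp
  qed (use finS sides real_sides in auto)
  have nn: "0 \<le> sum jump S" using sides(13) by (intro sum_nonneg) auto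
  have "test_gain (\<lambda>x. - F x) lo hi (1 / 2 ^ j) (\<Sum>r\<in>S. 2 * jump r)"
    by (rule ascents) (use lo_le_hi window in force)+
  then show "test_gain (\<lambda>x. - F x) lo hi (1 / 2 ^ j) (sum jump S / 2)"
    by (rule test_gain_mono) (use nn in \<open>auto simp flip: sum_distrib_left\<close>)
  define s t where "s = Min S" and "t = Max S"
  have s: "s \<in> S" and t: "t \<in> S" using finS ne by (auto simp: s_def t_def)
  show "test_gain F lo hi (1 / 2 ^ j) (sum jump S / 2)"
  proof (cases "s = t")
    case True
    then have "S \<subseteq> {t}" using finS by (auto simp: s_def t_def intro!: antisym Max_ge) (metis Min_le)
    then show ?thesis by (intro gain_decreasing_radii(1)) auto
  next
    case False
    then have st: "s < t" using finS s by (simp add: s_def t_def order_less_le)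
    show ?thesis
    proof (cases "l s - l t \<le> sum jump S / 2")
      case True
      have "test_gain (\<lambda>x. - (- F x)) lo hi (1 / 2 ^ j) ((\<Sum>r\<in>S. 2 * jump r) - jump s - jump t - (- l t - (- l s)))"
        unfolding s_def t_def by (rule descents[OF ne]) (rule inside)
      then have "test_gain F lo hi (1 / 2 ^ j) ((\<Sum>r\<in>S. 2 * jump r) - jump s - jump t - (l s - l t))"
        by (simp add: algebra_simps)
      then show ?thesis
        by (rule test_gain_mono)
           (use True two_jumps_le[OF s t False] in \<open>auto simp flip: sum_distrib_left\<close>)
    next
      case False
      define d where "d = q t - s"
      have "2 ^ j \<le> 2 * d" using sides(2,4)[OF t] st by (simp add: d_def)
      moreover have "4 * (q t - t) \<le> t - s" using sides(6)[OF t] spaced[OF s t st] by simp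
      ultimately have d: "0 < d" "4 * d \<le> 2 * int (w s) + 1" "d \<le> int (w s)" "2 ^ j \<le> 2 * d" "s < q t"
        using sides(2)[OF t] st near[OF s t] unfolding d_def by auto
      define m where "m = (2 * real (w s) + 1) * (l s + D s - l t)"
      have R: "0 < l s - l t" using False nn by simp
      have "2 * (l s - l t) \<le> m / (2 * real_of_int d)"
        unfolding m_def by (rule double_rise_le_mean) (use d R sides(7)[OF s] in auto)
      moreover have "l t + m / real_of_int (2 * d) \<le>
          sum F {s - int (w s)..<s - int (w s) + 2 * d} / real_of_int (2 * d)"
        using high_left[OF sides(10)[OF s] d(5) sides(9)[OF t]] d(1,3) R sides(7)[OF s]
        by (intro mean_ge_of_surplus) (auto simp: d_def m_def)
      ultimately have *: "l t + 2 * (l s - l t) \<le>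
          sum F {s - int (w s)..<s - int (w s) + 2 * d} / real_of_int (2 * d)" by simp
      have "sum jump S / 2 \<le> (l t + 2 * (l s - l t)) - (l s - jump s)"
        using False sides(13)[OF s] by simp
      then show ?thesis
        using sides(1,2,5)[OF s] window[OF s] d
        by (intro test_gain_of_means(1)[OF _ order_refl _ _ _ _ _ real_sides(3)[OF s] inverse_le_of_power_le[OF d(4)]
              mean_bounds(1)[OF s] *]) auto
    qed
  qed
qed

end

section \<open>Peaks in one block\<close>

text \<open>
  A block of scale \<open>n\<close> consists of the \<open>r\<close> with \<open>4 * r div 2 ^ n = k\<close>. Peaks with center in the
  block and radius between \<open>2 ^ n\<close> and \<open>2 ^ (n + 1)\<close> reflect only values of \<open>F\<close> in the window
  between the following bounds.
\<close>

definition block_lo :: "nat \<Rightarrow> int \<Rightarrow> int" where "block_lo n k = (k * 2 ^ n) div 4 - 12 * 2 ^ n + 1"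
definition block_hi :: "nat \<Rightarrow> int \<Rightarrow> int" where "block_hi n k = (k * 2 ^ n) div 4 + 12 * 2 ^ n"

lemma block_window: "(k - 48) * 2 ^ n \<le> 4 * block_lo n k \<and> 4 * block_hi n k \<le> (k + 48) * 2 ^ n"
proof -
  have "4 * (z div 4) \<le> z \<and> z \<le> 4 * (z div 4) + 4" for z :: int by presburger
  from this[of "k * 2 ^ n"] show ?thesis by (simp add: block_lo_def block_hi_def algebra_simps)
qed

lemma card_spaced_le:
  fixes I :: "int set" and a :: int and N :: nat
  assumes "finite I" "0 < a" "\<And>r s. r \<in> I \<Longrightarrow> s \<in> I \<Longrightarrow> r < s \<Longrightarrow> r + a \<le> s"
    and "\<And>r s. r \<in> I \<Longrightarrow> s \<in> I \<Longrightarrow> s - r < a * int N"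
  shows "card I \<le> N"
proof (cases "I = {}")
  case False
  define m where "m = Min I"
  have m: "m \<in> I" "\<And>r. r \<in> I \<Longrightarrow> m \<le> r" using assms(1) False by (auto simp: m_def)
  have "inj_on (\<lambda>r. (r - m) div a) I"
  proof (rule linorder_inj_onI')
    fix r s assume rs: "r \<in> I" "s \<in> I" "r < s"
    then have "(r - m) div a + 1 = (r - m + a) div a" using assms(2) by simp
    also have "\<dots> \<le> (s - m) div a" using assms(3)[OF rs] assms(2) by (intro zdiv_mono1) auto
    finally show "(r - m) div a \<noteq> (s - m) div a" by simp
  qed
  moreover have "(\<lambda>r. (r - m) div a) ` I \<subseteq> {0..<int N}"
  proof safe
    fix r assume r: "r \<in> I"
    have "r - m < a * int N" using assms(4)[OF m(1) r] .
    moreover have "(r - m) div a * a \<le> r - m"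
      using div_mult_mod_eq[of "r - m" a] pos_mod_sign[OF assms(2), of "r - m"] by linarith
    ultimately have "(r - m) div a * a < int N * a" by (simp only: mult.commute[of a])
    then have "(r - m) div a < int N" using assms(2) by simp
    moreover have "0 \<le> (r - m) div a" using m(2)[OF r] assms(2) by (simp add: pos_imp_zdiv_nonneg_iff)
    ultimately show "(r - m) div a \<in> {0..<int N}" by simp
  qed
  ultimately have "card I \<le> card {0..<int N}" by (intro card_inj_on_le) auto
  then show ?thesis by simp
qed simp

context discrete_maximal
begin

text \<open>
  At most \<open>2 ^ e\<close> peaks fit into the block. By Cauchy-Schwarz the sum of the squares of the \<open>D r\<close>
  is thus at least \<open>(sum D I)\<^sup>2 / 2 ^ e\<close>, and \<open>weighted_Erdos_Szekeres\<close> gives a chain with monotone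
  radii on which \<open>D\<close> sums to at least \<open>sum D I / sqrt (2 ^ e)\<close>. Each jump is at least \<open>2 ^ e / 4\<close>
  times \<open>D\<close>, so half of the sum of the jumps has the required size.
\<close>

lemma block_gain:
  fixes I :: "int set" and p q :: "int \<Rightarrow> int" and w :: "int \<Rightarrow> nat" and l D :: "int \<Rightarrow> real"
  assumes fin: "finite I" and ne: "I \<noteq> {}"
    and pk: "\<And>r. r \<in> I \<Longrightarrow> peak j (p r) r (q r) (w r) (l r) (D r)"
    and sp: "\<And>r s. r \<in> I \<Longrightarrow> s \<in> I \<Longrightarrow> r < s \<Longrightarrow> r + 8 * 2 ^ j \<le> s"
    and rad: "\<And>r. r \<in> I \<Longrightarrow> 2 ^ n \<le> w r \<and> w r < 2 ^ (n + 1)"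
    and blk: "\<And>r. r \<in> I \<Longrightarrow> (4 * r) div 2 ^ n = k"
    and e: "j + e = n + 1"
  shows "test_gain F (block_lo n k) (block_hi n k) (2 ^ e / 2 ^ (n + 1)) (sqrt (2 ^ e) / 8 * sum D I)"
    and "test_gain (\<lambda>x. - F x) (block_lo n k) (block_hi n k) (2 ^ e / 2 ^ (n + 1)) (sqrt (2 ^ e) / 8 * sum D I)"
proof -
  have Dpos: "0 < D r" if "r \<in> I" for r using pk[OF that] by (simp add: peak_def)
  have pos: "k * 2 ^ n \<le> 4 * r \<and> 4 * r < k * 2 ^ n + 2 ^ n" if "r \<in> I" for r
  proof -
    have "4 * r = k * 2 ^ n + (4 * r) mod 2 ^ n" using blk[OF that] by (metis div_mult_mod_eq)
    moreover have "0 \<le> (4 * r) mod 2 ^ n" "(4 * r) mod 2 ^ n < 2 ^ n" by simp_all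
    ultimately show ?thesis by linarith
  qed
  have rad': "2 ^ n \<le> int (w r) \<and> int (w r) < 2 * 2 ^ n" if "r \<in> I" for r
    using rad[OF that] by (metis of_nat_le_iff of_nat_less_iff of_nat_numeral of_nat_power power_Suc Suc_eq_plus1)
  have jn: "(2::int) ^ (j + 2) \<le> 8 * 2 ^ n"
  proof -
    have "(2::int) ^ (j + 2) \<le> 2 ^ (n + 3)" using e by (intro power_increasing) auto
    then show ?thesis by (simp add: power_add)
  qed
  define mono where "mono S \<longleftrightarrow> (\<forall>r\<in>S. \<forall>s\<in>S. r < s \<longrightarrow> w s \<le> w r) \<or> (\<forall>r\<in>S. \<forall>s\<in>S. r < s \<longrightarrow> w r \<le> w s)" for S
  define \<C> where "\<C> = {S. S \<subseteq> I \<and> mono S}"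
  define U where "U = Max (sum D ` \<C>)"
  have fC: "finite \<C>" unfolding \<C>_def using fin by auto
  have Uge: "sum D S \<le> U" if "S \<in> \<C>" for S unfolding U_def using fC that by (intro Max_ge) auto
  have "{} \<in> \<C>" by (auto simp: \<C>_def mono_def)
  then have "U \<in> sum D ` \<C>" unfolding U_def using fC by (intro Max_in) auto
  then obtain S where S: "S \<in> \<C>" "U = sum D S" by blast
  obtain r0 where r0: "r0 \<in> I" using ne by blast
  have "{r0} \<in> \<C>" using r0 by (auto simp: \<C>_def mono_def)
  then have U0: "0 < U" using Uge[of "{r0}"] Dpos[OF r0] by simp
  then have Sne: "S \<noteq> {}" using S by auto
  have SI: "S \<subseteq> I" and Sm: "mono S" using S by (auto simp: \<C>_def)
  interpret peak_chain F u V S j p q w l D "block_lo n k" "block_hi n k"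
  proof unfold_locales
    show "finite S" using SI fin finite_subset by blast
    show "S \<noteq> {}" by (rule Sne)
    fix r assume "r \<in> S"
    then have r: "r \<in> I" using SI by auto
    show "peak j (p r) r (q r) (w r) (l r) (D r)" by (rule pk[OF r])
    show "block_lo n k \<le> r - int (w r) - 2 ^ (j + 2) \<and> r + int (w r) + 1 + 2 ^ (j + 2) \<le> block_hi n k"
      using pos[OF r] rad'[OF r] jn unfolding block_lo_def block_hi_def by linarith
    fix s assume "s \<in> S"
    then have s: "s \<in> I" using SI by auto
    show "r + 8 * 2 ^ j \<le> s" if "r < s" by (rule sp[OF r s that])
    have "4 * \<bar>s - r\<bar> < 2 ^ n" using pos[OF r] pos[OF s] by (auto simp: abs_if)
    then show "4 * \<bar>s - r\<bar> \<le> int (w r)" using rad'[OF r] by linarith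
  qed
  have "card I \<le> 2 ^ e"
  proof (rule card_spaced_le[OF fin _ sp])
    fix r s assume r: "r \<in> I" and s: "s \<in> I"
    have "8 * 2 ^ j * int (2 ^ e) = 8 * 2 ^ (j + e)" by (simp add: power_add)
    also have "\<dots> = 16 * 2 ^ n" by (simp add: e)
    finally have "8 * 2 ^ j * int (2 ^ e) = 16 * 2 ^ n" .
    then show "s - r < 8 * 2 ^ j * int (2 ^ e)" using pos[OF r] pos[OF s] by linarith
  qed auto
  have "(sum D I)\<^sup>2 \<le> real (card I) * (\<Sum>r\<in>I. (D r)\<^sup>2)"
    using Cauchy_Schwarz_ineq_sum[of "\<lambda>_. 1" D I] by simp
  also have "\<dots> \<le> 2 ^ e * (\<Sum>r\<in>I. (D r)\<^sup>2)"
  proof (rule mult_right_mono)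
    show "real (card I) \<le> 2 ^ e" using \<open>card I \<le> 2 ^ e\<close> by (metis of_nat_le_iff of_nat_numeral of_nat_power)
  qed (auto intro: sum_nonneg)
  also have "\<dots> \<le> 2 ^ e * (U * U)"
  proof (intro mult_left_mono weighted_Erdos_Szekeres)
    fix T assume T: "T \<subseteq> I"
    show "sum D T \<le> U" if "\<And>r s. r \<in> T \<Longrightarrow> s \<in> T \<Longrightarrow> r < s \<Longrightarrow> w s \<le> w r"
      by (rule Uge) (use T that in \<open>auto simp: \<C>_def mono_def\<close>)
    show "sum D T \<le> U" if "\<And>r s. r \<in> T \<Longrightarrow> s \<in> T \<Longrightarrow> r < s \<Longrightarrow> w r \<le> w s"
      by (rule Uge) (use T that in \<open>auto simp: \<C>_def mono_def\<close>)
  qed (use fin Dpos less_imp_le in auto)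
  finally have CS: "(sum D I)\<^sup>2 \<le> 2 ^ e * U\<^sup>2" by (simp add: power2_eq_square)
  have "sum D I \<le> sqrt (2 ^ e) * U"
  proof (rule power2_le_imp_le)
    show "(sum D I)\<^sup>2 \<le> (sqrt (2 ^ e) * U)\<^sup>2" using CS by (simp add: power_mult_distrib)
  qed (use U0 in auto)
  then have "sqrt (2 ^ e) * sum D I \<le> sqrt (2 ^ e) * (sqrt (2 ^ e) * U)"
    by (rule mult_left_mono) simp
  also have "\<dots> = 2 ^ e * U" by (simp flip: mult.assoc)
  finally have 1: "sqrt (2 ^ e) / 8 * sum D I \<le> 2 ^ e / 8 * U" by simp
  have "2 ^ e / 4 * U = (\<Sum>r\<in>S. 2 ^ e / 4 * D r)" by (simp add: S(2) sum_distrib_left)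
  also have "\<dots> \<le> sum jump S"
  proof (rule sum_mono)
    fix r assume "r \<in> S"
    then have r: "r \<in> I" using SI by auto
    have "(2::real) ^ n \<le> real (w r)" using rad[OF r] by simp
    then have wr: "2 * 2 ^ n \<le> 2 * real (w r) + 1" by linarith
    have "(2::real) ^ e * 2 ^ j = 2 ^ (j + e)" by (simp add: power_add)
    then have ej: "(2::real) ^ e * 2 ^ j = 2 * 2 ^ n" by (simp add: e)
    have "2 ^ e / 4 * D r = (2 ^ e * 2 ^ j) * D r / 2 ^ (j + 2)" by (simp add: power_add)
    also have "\<dots> = (2 * 2 ^ n) * D r / 2 ^ (j + 2)" by (simp only: ej)
    also have "\<dots> \<le> jump r" unfolding jump_def
      using wr Dpos[OF r] by (intro divide_right_mono mult_right_mono) auto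
    finally show "2 ^ e / 4 * D r \<le> jump r" .
  qed
  finally have 2: "sqrt (2 ^ e) / 8 * sum D I \<le> sum jump S / 2" using 1 by (simp add: mult.commute)
  have c: "1 / 2 ^ j \<le> (2::real) ^ e / 2 ^ (n + 1)"
    unfolding e[symmetric] by (simp add: power_add)
  have "test_gain F (block_lo n k) (block_hi n k) (1 / 2 ^ j) (sum jump S / 2) \<and>
      test_gain (\<lambda>x. - F x) (block_lo n k) (block_hi n k) (1 / 2 ^ j) (sum jump S / 2)"
    using Sm gain_decreasing_radii gain_increasing_radii unfolding mono_def by blast
  then show "test_gain F (block_lo n k) (block_hi n k) (2 ^ e / 2 ^ (n + 1)) (sqrt (2 ^ e) / 8 * sum D I)"
    "test_gain (\<lambda>x. - F x) (block_lo n k) (block_hi n k) (2 ^ e / 2 ^ (n + 1)) (sqrt (2 ^ e) / 8 * sum D I)"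
    using test_gain_mono[OF _ order_refl order_refl c 2] by blast+
qed

end

section \<open>Summing over blocks and scales\<close>

lemma scale_series_le: "(\<Sum>e<M. real (e + 4) / sqrt (2 ^ e)) \<le> 4 / (1 - 1 / sqrt 2)\<^sup>2"
proof -
  define x where "x = 1 / sqrt (2::real)"
  have x: "0 < x" "x < 1" by (auto simp: x_def)
  have s: "(\<lambda>e. of_nat (Suc e) * x ^ e) sums (1 / (1 - x)\<^sup>2)"
    by (rule geometric_deriv_sums) (use x in auto)
  have "(\<Sum>e<M. real (e + 4) / sqrt (2 ^ e)) \<le> (\<Sum>e<M. 4 * (of_nat (Suc e) * x ^ e))"
  proof (rule sum_mono)
    fix e
    have "real (e + 4) / sqrt (2 ^ e) = real (e + 4) * x ^ e"
      by (simp add: x_def real_sqrt_power power_one_over divide_inverse power_inverse)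
    also have "\<dots> \<le> (4 * real (Suc e)) * x ^ e" using x by (intro mult_right_mono) auto
    finally show "real (e + 4) / sqrt (2 ^ e) \<le> 4 * (of_nat (Suc e) * x ^ e)" by (simp only: mult.assoc)
  qed
  also have "\<dots> = 4 * (\<Sum>e<M. of_nat (Suc e) * x ^ e)" by (simp add: sum_distrib_left)
  also have "\<dots> \<le> 4 * (1 / (1 - x)\<^sup>2)"
  proof (rule mult_left_mono)
    show "(\<Sum>e<M. of_nat (Suc e) * x ^ e) \<le> 1 / (1 - x)\<^sup>2"
      using x sums_unique[OF s] sum_le_suminf[OF sums_summable[OF s], of "{..<M}"] by simp
  qed simp
  finally show ?thesis by (simp add: x_def)
qed

text \<open>
  The factor \<open>32768\<close> is \<open>16\<close>, from the bound for one class of peaks, times \<open>2048\<close>, from the number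
  of classes; the other factor bounds the sum over all ratios of radius to width.
\<close>

definition peak_const :: real where "peak_const = 32768 * (4 / (1 - 1 / sqrt 2)\<^sup>2)"

context discrete_maximal
begin

lemma V_nonneg: "0 \<le> V" using total_variation[of "{}"] by simp

text \<open>
  The ratio of radius to width is fixed here by \<open>e\<close>. The congruence conditions on the scales \<open>n i\<close>
  and on the blocks \<open>k i\<close> keep the scales \<open>e + 4\<close> apart and the windows of one scale disjoint, as
  \<open>multiscale_gain\<close> requires.
\<close>

lemma fixed_ratio_class_bound:
  fixes C :: "'i set" and j n w :: "'i \<Rightarrow> nat" and k p r q :: "'i \<Rightarrow> int" and l D :: "'i \<Rightarrow> real"
  assumes fin: "finite C"
    and pk: "\<And>i. i \<in> C \<Longrightarrow> peak (j i) (p i) (r i) (q i) (w i) (l i) (D i)"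
    and rad: "\<And>i. i \<in> C \<Longrightarrow> 2 ^ n i \<le> w i \<and> w i < 2 ^ (n i + 1)"
    and blk: "\<And>i. i \<in> C \<Longrightarrow> (4 * r i) div 2 ^ n i = k i"
    and e: "\<And>i. i \<in> C \<Longrightarrow> j i + e = n i + 1"
    and sp: "\<And>i i'. i \<in> C \<Longrightarrow> i' \<in> C \<Longrightarrow> i \<noteq> i' \<Longrightarrow> j i = j i' \<Longrightarrow> 8 * 2 ^ j i \<le> \<bar>r i - r i'\<bar>"
    and nmod: "\<And>i. i \<in> C \<Longrightarrow> n i mod (e + 4) = \<rho>"
    and kmod: "\<And>i. i \<in> C \<Longrightarrow> k i mod 128 = \<kappa>"
  shows "sum D C \<le> 16 * V / sqrt (2 ^ e)"
proof -
  define B where "B m c = {i \<in> {i\<in>C. n i = m}. k i = c}" for m c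
  define K where "K m = k ` {i\<in>C. n i = m}" for m
  have gain: "test_gain F (block_lo m c) (block_hi m c) (2 ^ e / 2 ^ (m + 1)) (sqrt (2 ^ e) / 8 * sum D (B m c)) \<and>
     test_gain (\<lambda>x. - F x) (block_lo m c) (block_hi m c) (2 ^ e / 2 ^ (m + 1)) (sqrt (2 ^ e) / 8 * sum D (B m c))"
    if m: "m \<in> n ` C" "c \<in> K m" for m c
  proof -
    have finB: "finite (B m c)" using fin by (simp add: B_def)
    have neB: "B m c \<noteq> {}" using m by (auto simp: B_def K_def)
    have BC: "i \<in> C" "n i = m" "k i = c" if "i \<in> B m c" for i using that by (auto simp: B_def)
    obtain i0 where i0: "i0 \<in> B m c" using neB by blast
    have jB: "j i = j i0" if "i \<in> B m c" for i
      using e[OF BC(1)[OF that]] e[OF BC(1)[OF i0]] BC(2)[OF that] BC(2)[OF i0] by simp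
    have far: "8 * 2 ^ j i0 \<le> \<bar>r i - r i'\<bar>" if "i \<in> B m c" "i' \<in> B m c" "i \<noteq> i'" for i i'
      using sp[OF BC(1)[OF that(1)] BC(1)[OF that(2)] that(3)] jB[OF that(1)] jB[OF that(2)] by simp
    have inj: "inj_on r (B m c)"
    proof (rule inj_onI, rule ccontr)
      fix i i' assume ii: "i \<in> B m c" "i' \<in> B m c" "r i = r i'" "i \<noteq> i'"
      have "(0::int) < 8 * 2 ^ j i0" by simp
      then show False using far[OF ii(1,2,4)] ii(3) by simp
    qed
    define g where "g = inv_into (B m c) r"
    have g: "g (r i) = i" if "i \<in> B m c" for i using inj that by (simp add: g_def)
    have s: "sum (\<lambda>x. D (g x)) (r ` B m c) = sum D (B m c)"
      by (subst sum.reindex[OF inj]) (auto simp: g intro!: sum.cong)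
    have hyp: "peak (j i0) (p (g x)) x (q (g x)) (w (g x)) (l (g x)) (D (g x))"
       "2 ^ m \<le> w (g x) \<and> w (g x) < 2 ^ (m + 1)" "(4 * x) div 2 ^ m = c"
      if "x \<in> r ` B m c" for x
      using that pk[OF BC(1)] rad[OF BC(1)] blk[OF BC(1)] BC(2,3) jB by (auto simp: g)
    have spB: "x + 8 * 2 ^ j i0 \<le> y" if "x \<in> r ` B m c" "y \<in> r ` B m c" "x < y" for x y
      using that far by force
    have "j i0 + e = m + 1" using e[OF BC(1)[OF i0]] BC(2)[OF i0] by simp
    note je = this
    have I: "finite (r ` B m c)" "r ` B m c \<noteq> {}" using finB neB by auto
    show ?thesis
      using block_gain(1)[OF I hyp(1) spB hyp(2,3) je] block_gain(2)[OF I hyp(1) spB hyp(2,3) je]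
      unfolding s by (rule conjI)
  qed
  have "(\<Sum>m\<in>n ` C. \<Sum>c\<in>K m. sqrt (2 ^ e) / 8 * sum D (B m c)) \<le> 2 * V"
  proof (rule multiscale_gain[where e = e and F = F and lo = block_lo and hi = block_hi])
    show "finite (n ` C)" "\<And>m. finite (K m)" using fin by (auto simp: K_def)
    fix m assume m: "m \<in> n ` C"
    show "m + e + 4 \<le> m'" if "m' \<in> n ` C" "m < m'" for m'
    proof -
      have "m mod (e + 4) = m' mod (e + 4)" using m that(1) nmod by auto
      then have "e + 4 dvd m' - m" using that(2) by (metis less_imp_le mod_eq_dvd_iff_nat)
      then have "e + 4 \<le> m' - m" using that(2) by (intro dvd_imp_le) auto
      then show ?thesis by simp
    qed
    fix c assume c: "c \<in> K m"
    show "c + 128 \<le> c'" if "c' \<in> K m" "c < c'" for c'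
    proof -
      have "c' mod 128 = c mod 128" using c that(1) kmod by (auto simp: K_def)
      then have "128 dvd c' - c" by (simp add: mod_eq_dvd_iff)
      then have "128 \<le> c' - c" using that(2) by (intro zdvd_imp_le) auto
      then show ?thesis by simp
    qed
    show "(c - 48) * 2 ^ m \<le> 4 * block_lo m c \<and> 4 * block_hi m c \<le> (c + 48) * 2 ^ m" by (rule block_window)
    show "test_gain F (block_lo m c) (block_hi m c) (2 ^ e / 2 ^ (m + 1)) (sqrt (2 ^ e) / 8 * sum D (B m c))"
      "test_gain (\<lambda>x. - F x) (block_lo m c) (block_hi m c) (2 ^ e / 2 ^ (m + 1)) (sqrt (2 ^ e) / 8 * sum D (B m c))"
      using gain[OF m c] by blast+
  qed (rule total_variation)
  also have "(\<Sum>m\<in>n ` C. \<Sum>c\<in>K m. sqrt (2 ^ e) / 8 * sum D (B m c)) = sqrt (2 ^ e) / 8 * (\<Sum>m\<in>n ` C. \<Sum>c\<in>K m. sum D (B m c))"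
    by (simp add: sum_distrib_left)
  also have "(\<Sum>m\<in>n ` C. \<Sum>c\<in>K m. sum D (B m c)) = (\<Sum>m\<in>n ` C. sum D {i\<in>C. n i = m})"
    unfolding K_def B_def
    by (rule sum.cong[OF refl], rule sum.image_gen[symmetric]) (simp add: fin)
  also have "\<dots> = sum D C" by (rule sum.image_gen[symmetric]) (rule fin)
  finally show ?thesis by (simp add: field_simps)
qed

text \<open>
  Let \<open>e\<close> be the binary logarithm of twice the ratio of radius to width, up to rounding. There are
  \<open>2048 * (e + 4)\<close> classes of residues for each \<open>e\<close>, each contributing at most \<open>16 * V / sqrt (2 ^
  e)\<close>. The residue modulo \<open>16\<close> of the second index separates the peaks of equal width: their
  centers are within two widths of multiples of the width.
\<close>

lemma all_peaks_bound:
  fixes Q :: "(nat \<times> int) set" and p r q :: "nat \<times> int \<Rightarrow> int" and w :: "nat \<times> int \<Rightarrow> nat" and l D :: "nat \<times> int \<Rightarrow> real"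
  assumes fin: "finite Q"
    and pk: "\<And>i. i \<in> Q \<Longrightarrow> peak (fst i) (p i) (r i) (q i) (w i) (l i) (D i)"
    and near: "\<And>i. i \<in> Q \<Longrightarrow> \<bar>r i - snd i * 2 ^ fst i\<bar> < 2 * 2 ^ fst i"
  shows "sum D Q \<le> peak_const * V"
proof -
  have "\<exists>m. 2 ^ m \<le> w i \<and> w i < 2 ^ (m + 1)" if "i \<in> Q" for i
  proof -
    have "p i < r i" using pk[OF that] by (simp add: peak_def)
    then have "1 \<le> w i" using peak_radius(1)[OF pk[OF that]] by simp
    then show ?thesis by (intro ex_power_ivl1) auto
  qed
  then obtain n where n: "\<And>i. i \<in> Q \<Longrightarrow> 2 ^ n i \<le> w i \<and> w i < 2 ^ (n i + 1)" by metis
  have jn: "fst i \<le> n i + 1" if "i \<in> Q" for i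
  proof -
    have "2 ^ fst i \<le> 2 * int (w i)"
      using pk[OF that] peak_radius(1)[OF pk[OF that]] by (simp add: peak_def)
    also have "\<dots> < 2 * int (2 ^ (n i + 1))"
    proof -
      have "int (w i) < int (2 ^ (n i + 1))" using n[OF that] by (simp only: of_nat_less_iff)
      then show ?thesis by simp
    qed
    also have "\<dots> = 2 ^ (n i + 2)" by simp
    finally have "(2::int) ^ fst i < 2 ^ (n i + 2)" .
    then have "fst i < n i + 2" by (simp only: power_strict_increasing_iff)
    then show ?thesis by simp
  qed
  define k where "k i = (4 * r i) div 2 ^ n i" for i
  define e where "e i = n i + 1 - fst i" for i
  obtain M where M: "e ` Q \<subseteq> {..<M}" using fin finite_nat_set_iff_bounded[of "e ` Q"] by auto
  have level: "sum D {i\<in>Q. e i = d} \<le> 32768 * V * (real (d + 4) / sqrt (2 ^ d))" for d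
  proof -
    define Qd where "Qd = {i\<in>Q. e i = d}"
    define T where "T = {..<d + 4} \<times> {0..<128::int} \<times> {0..<16::int}"
    define cl where "cl i = (n i mod (d + 4), k i mod 128, snd i mod 16)" for i
    have "sum D Qd = (\<Sum>t\<in>T. sum D {i\<in>Qd. cl i = t})"
      by (rule sum.group[symmetric]) (use fin in \<open>auto simp: Qd_def T_def cl_def\<close>)
    also have "\<dots> \<le> real (card T) * (16 * V / sqrt (2 ^ d))"
    proof (rule sum_bounded_above)
      fix t assume "t \<in> T"
      obtain \<rho> \<kappa> \<zeta> where t: "t = (\<rho>, \<kappa>, \<zeta>)" by (metis prod_cases3)
      show "sum D {i\<in>Qd. cl i = t} \<le> 16 * V / sqrt (2 ^ d)"
      proof (rule fixed_ratio_class_bound[where j = fst and n = n and k = k and \<rho> = \<rho> and \<kappa> = \<kappa>])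
        show "finite {i\<in>Qd. cl i = t}" using fin by (simp add: Qd_def)
        fix i assume i: "i \<in> {i\<in>Qd. cl i = t}"
        then have iQ: "i \<in> Q" by (simp add: Qd_def)
        show "peak (fst i) (p i) (r i) (q i) (w i) (l i) (D i)" by (rule pk[OF iQ])
        show "2 ^ n i \<le> w i \<and> w i < 2 ^ (n i + 1)" by (rule n[OF iQ])
        show "(4 * r i) div 2 ^ n i = k i" by (simp add: k_def)
        show "fst i + d = n i + 1" using i jn[OF iQ] by (auto simp: Qd_def e_def)
        show "n i mod (d + 4) = \<rho>" "k i mod 128 = \<kappa>" using i by (auto simp: cl_def t)
        fix i' assume i': "i' \<in> {i\<in>Qd. cl i = t}" "i \<noteq> i'" "fst i = fst i'"
        then have iQ': "i' \<in> Q" by (simp add: Qd_def)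
        have "snd i \<noteq> snd i'" using i'(2,3) by (simp add: prod_eq_iff)
        moreover have "snd i mod 16 = snd i' mod 16" using i i' by (auto simp: cl_def t)
        then have "16 dvd snd i - snd i'" by (simp only: mod_eq_dvd_iff)
        ultimately have "16 \<le> \<bar>snd i - snd i'\<bar>"
          by (metis abs_of_nonneg dvd_imp_le_int right_minus_eq zero_le_numeral)
        then have "16 * 2 ^ fst i \<le> \<bar>snd i - snd i'\<bar> * 2 ^ fst i" by (intro mult_right_mono) auto
        also have "\<dots> = \<bar>snd i * 2 ^ fst i - snd i' * 2 ^ fst i\<bar>"
          by (simp add: abs_mult flip: left_diff_distrib)
        finally show "8 * 2 ^ fst i \<le> \<bar>r i - r i'\<bar>"
          using near[OF iQ] near[OF iQ'] i'(3) by simp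
      qed
    qed
    also have "\<dots> = 32768 * V * (real (d + 4) / sqrt (2 ^ d))" by (simp add: T_def field_simps)
    finally show ?thesis by (simp add: Qd_def)
  qed
  have "sum D Q = (\<Sum>d<M. sum D {i\<in>Q. e i = d})"
    by (rule sum.group[symmetric]) (use fin M in auto)
  also have "\<dots> \<le> (\<Sum>d<M. 32768 * V * (real (d + 4) / sqrt (2 ^ d)))" by (intro sum_mono level)
  also have "\<dots> = 32768 * V * (\<Sum>d<M. real (d + 4) / sqrt (2 ^ d))" by (simp add: sum_distrib_left)
  also have "\<dots> \<le> 32768 * V * (4 / (1 - 1 / sqrt 2)\<^sup>2)"
    using V_nonneg by (intro mult_left_mono scale_series_le) auto
  finally show ?thesis by (simp add: peak_const_def mult_ac)
qed

end

section \<open>Decomposing the variation into peaks\<close>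

text \<open>
  The induction takes the intervals in the order of their right ends.
\<close>

lemma sum_disjoint_lengths_le:
  fixes \<alpha> \<beta> :: "'i \<Rightarrow> real"
  assumes "finite B" "\<And>x. x \<in> B \<Longrightarrow> \<alpha> x < \<beta> x"
    and "\<And>x y. x \<in> B \<Longrightarrow> y \<in> B \<Longrightarrow> x \<noteq> y \<Longrightarrow> \<beta> x \<le> \<alpha> y \<or> \<beta> y \<le> \<alpha> x"
    and "\<And>x. x \<in> B \<Longrightarrow> a \<le> \<alpha> x" "\<And>x. x \<in> B \<Longrightarrow> \<beta> x \<le> b" "a \<le> b"
  shows "(\<Sum>x\<in>B. \<beta> x - \<alpha> x) \<le> b - a"
proof -
  have "S \<subseteq> B \<longrightarrow> (\<forall>b. (\<forall>x\<in>S. \<beta> x \<le> b) \<longrightarrow> a \<le> b \<longrightarrow> (\<Sum>x\<in>S. \<beta> x - \<alpha> x) \<le> b - a)"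
    if "finite S" for S
    using that
  proof (induction S rule: finite_ranking_induct[where f = \<beta>])
    case (insert x S)
    show ?case
    proof (cases "x \<in> S")
      case True
      then show ?thesis using insert.IH by (simp add: insert_absorb)
    next
      case False
      show ?thesis
      proof (intro impI allI)
        fix b assume sub: "insert x S \<subseteq> B" and b: "\<forall>y\<in>insert x S. \<beta> y \<le> b" "a \<le> b"
        have "\<beta> y \<le> \<alpha> x" if "y \<in> S" for y
          using assms(3)[of x y] assms(2)[of y] insert.hyps(2)[OF that] that sub False by force
        then have "(\<Sum>x\<in>S. \<beta> x - \<alpha> x) \<le> \<alpha> x - a"
          using insert.IH sub assms(4)[of x] by auto
        then show "(\<Sum>y\<in>insert x S. \<beta> y - \<alpha> y) \<le> b - a" using b False insert.hyps(1) by simp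
      qed
    qed
  qed simp
  from this[OF assms(1)] show ?thesis using assms(5,6) by simp
qed

context discrete_maximal
begin

text \<open>
  For a level \<open>t\<close>, the maximal intervals on which \<open>u > t\<close> are the sets \<open>{k<..<q}\<close> with \<open>u k, u q \<le>
  t < upper k q\<close>. The condition \<open>lower k q \<le> t\<close> demands in addition that \<open>F \<le> t\<close> on this interval.
  So \<open>upper k q - lower k q\<close>, if positive, measures the set of levels at which \<open>{k<..<q}\<close> is such
  an interval.
\<close>

definition upper :: "int \<Rightarrow> int \<Rightarrow> real" where "upper k q = Min (u ` {k<..<q})"

definition lower0 :: "int \<Rightarrow> int \<Rightarrow> real" where "lower0 k q = Max (insert (u k) (F ` {k<..<q}))"

definition lower :: "int \<Rightarrow> int \<Rightarrow> real" where "lower k q = max (lower0 k q) (u q)"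

lemma upper_le: "k < x \<Longrightarrow> x < q \<Longrightarrow> upper k q \<le> u x"
  unfolding upper_def by (intro Min_le) auto

lemma lower0_ge: "u k \<le> lower0 k q" "k < x \<Longrightarrow> x < q \<Longrightarrow> F x \<le> lower0 k q"
  unfolding lower0_def by (intro Max_ge; auto)+

lemma lower_ge: "u k \<le> lower k q" "u q \<le> lower k q" "k < x \<Longrightarrow> x < q \<Longrightarrow> F x \<le> lower k q"
  unfolding lower_def using lower0_ge by (auto intro: max.coboundedI1)

lemma upper_step: "upper k (k + 2) = u (k + 1)" "k + 2 \<le> q \<Longrightarrow> upper k (q + 1) = min (upper k q) (u q)"
proof -
  have "{k<..<k + 2} = {k + 1}" by auto
  then show "upper k (k + 2) = u (k + 1)" by (simp add: upper_def)
  assume q: "k + 2 \<le> q"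
  then have eq: "{k<..<q + 1} = insert q {k<..<q}" and "k + 1 \<in> {k<..<q}" by auto
  then have ne: "{k<..<q} \<noteq> {}" by blast
  have "upper k (q + 1) = min (u q) (upper k q)"
    unfolding upper_def eq image_insert by (rule Min_insert) (use ne in auto)
  then show "upper k (q + 1) = min (upper k q) (u q)" by (simp only: min.commute)
qed

lemma lower0_step: "lower0 k (k + 1) = u k" "k + 1 \<le> q \<Longrightarrow> lower0 k (q + 1) = max (lower0 k q) (F q)"
proof -
  have "{k<..<k + 1} = {}" by auto
  then show "lower0 k (k + 1) = u k" by (simp add: lower0_def)
  assume q: "k + 1 \<le> q"
  then have "{k<..<q + 1} = insert q {k<..<q}" by auto
  then have eq: "insert (u k) (F ` {k<..<q + 1}) = insert (F q) (insert (u k) (F ` {k<..<q}))"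
    by (simp only: image_insert insert_commute)
  have "lower0 k (q + 1) = max (F q) (lower0 k q)"
    unfolding lower0_def eq by (rule Max_insert) auto
  then show "lower0 k (q + 1) = max (lower0 k q) (F q)" by (simp only: max.commute)
qed

text \<open>
  The pairs in \<open>B\<close> have comparable lengths and a common point, so they are nested, with disjoint
  sets of levels that move up as the intervals get smaller. They merge into one peak: its feet are
  the ends of the lowest, hence longest, interval, and its center \<open>r\<close> is the midpoint of the
  highest interval, where \<open>u\<close> exceeds all the levels. The highest interval is long as well, which
  keeps \<open>r\<close> away from both feet.
\<close>

lemma fibre_peak:
  assumes fin: "finite B" and ne: "B \<noteq> {}"
    and B: "\<And>k q. (k, q) \<in> B \<Longrightarrow> k + 2 \<le> q \<and> lower k q < upper k q \<and> 2 ^ j \<le> q - k \<and> q - k < 2 ^ (j + 1) \<and>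
        k < z * 2 ^ j \<and> z * 2 ^ j \<le> q"
  shows "\<exists>p r q w l D. peak j p r q w l D \<and> \<bar>r - z * 2 ^ j\<bar> < 2 * 2 ^ j \<and>
     (\<Sum>(k, q)\<in>B. upper k q - lower k q) \<le> 2 * D"
proof -
  define \<alpha> where "\<alpha> x = lower (fst x) (snd x)" for x
  define \<beta> where "\<beta> x = upper (fst x) (snd x)" for x
  define a where "a = Min (\<alpha> ` B)"
  define b where "b = Max (\<beta> ` B)"
  have "a \<in> \<alpha> ` B" unfolding a_def using fin ne by (intro Min_in) auto
  then obtain k q where kq: "(k, q) \<in> B" "a = lower k q" by (auto simp: \<alpha>_def)
  have "b \<in> \<beta> ` B" unfolding b_def using fin ne by (intro Max_in) auto
  then obtain k' q' where kq': "(k', q') \<in> B" "b = upper k' q'" by (auto simp: \<beta>_def)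
  have a: "a \<le> \<alpha> x" if "x \<in> B" for x unfolding a_def using fin that by (intro Min_le) auto
  have b: "\<beta> x \<le> b" if "x \<in> B" for x unfolding b_def using fin that by (intro Max_ge) auto
  have ab: "a < b" using a[OF kq(1)] b[OF kq(1)] B[OF kq(1)] by (simp add: \<alpha>_def \<beta>_def)
  have eq: "k1 = k2 \<and> q1 = q2" if 1: "(k1, q1) \<in> B" and 2: "(k2, q2) \<in> B"
    and lev: "lower k1 q1 \<le> t" "t < upper k1 q1" "lower k2 q2 \<le> t" "t < upper k2 q2" for k1 q1 k2 q2 t
  proof -
    have "\<not> k1 < k2"
      using B[OF 1] B[OF 2] upper_le[of k1 k2 q1] lower_ge(1)[of k2 q2] lev by force
    moreover have "\<not> k2 < k1"
      using B[OF 1] B[OF 2] upper_le[of k2 k1 q2] lower_ge(1)[of k1 q1] lev by force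
    moreover have "\<not> q1 < q2"
      using B[OF 1] B[OF 2] upper_le[of k2 q1 q2] lower_ge(2)[of q1 k1] lev by force
    moreover have "\<not> q2 < q1"
      using B[OF 1] B[OF 2] upper_le[of k1 q2 q1] lower_ge(2)[of q2 k2] lev by force
    ultimately show ?thesis by simp
  qed
  have sum: "(\<Sum>x\<in>B. \<beta> x - \<alpha> x) \<le> b - a"
  proof (rule sum_disjoint_lengths_le[OF fin _ _ a b])
    show "\<alpha> x < \<beta> x" if "x \<in> B" for x using B[of "fst x" "snd x"] that by (simp add: \<alpha>_def \<beta>_def)
    show "\<beta> x \<le> \<alpha> y \<or> \<beta> y \<le> \<alpha> x" if xy: "x \<in> B" "y \<in> B" "x \<noteq> y" for x y
    proof (rule ccontr)
      assume "\<not> ?thesis"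
      moreover have "\<alpha> x < \<beta> x" "\<alpha> y < \<beta> y"
        using B[of "fst x" "snd x"] B[of "fst y" "snd y"] xy by (simp_all add: \<alpha>_def \<beta>_def)
      ultimately have "fst x = fst y \<and> snd x = snd y"
        using xy by (intro eq[of _ _ _ _ "max (\<alpha> x) (\<alpha> y)"]) (auto simp: \<alpha>_def \<beta>_def)
      then show False using xy(3) by (simp add: prod_eq_iff)
    qed
  qed (use ab in auto)
  have aa: "a \<le> lower k' q'" using a[OF kq'(1)] by (simp add: \<alpha>_def)
  have low': "lower k' q' < b" using B[OF kq'(1)] kq'(2) by simp
  have kk: "k \<le> k'"
    using B[OF kq(1)] B[OF kq'(1)] upper_le[of k' k q'] lower_ge(1)[of k q] kq kq' ab by force
  have qq: "q' \<le> q"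
    using B[OF kq(1)] B[OF kq'(1)] upper_le[of k' q q'] lower_ge(2)[of q k] kq kq' ab by force
  define r where "r = (k' + q') div 2"
  define D where "D = (b - a) / 2"
  have D: "0 < D" "a + D < b" using ab by (simp_all add: D_def field_simps)
  have r: "k' < r" "r < q'" using B[OF kq'(1)] by (auto simp: r_def)
  have "b \<le> u r" using upper_le[OF r] kq'(2) by simp
  then have "a + D < u r" using D by simp
  then obtain w where w: "(2 * real w + 1) * (a + D) < sum F {r - int w..<r + int w + 1}"
    using nearly_attained by blast
  \<comment> \<open>The width \<open>2 ^ j\<close> is even, so rounding in the midpoint does no harm.\<close>
  have "j \<noteq> 0" using B[OF kq'(1)] by (intro notI) auto
  then have ev: "(2::int) ^ j = 2 * 2 ^ (j - 1)" by (metis power_eq_if)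
  have "2 * c \<le> 2 * ((x + y) div 2 - x) \<and> 2 * c \<le> 2 * (y - (x + y) div 2)" if "2 * c \<le> y - x" for c x y :: int
    using that by presburger
  moreover have "2 * 2 ^ (j - 1) \<le> q' - k'" using B[OF kq'(1)] unfolding ev by blast
  ultimately have half: "2 ^ j \<le> 2 * (r - k')" "2 ^ j \<le> 2 * (q' - r)"
    unfolding ev r_def by blast+
  have "\<forall>x. k < x \<and> x < q \<longrightarrow> F x \<le> a" using lower_ge(3) kq(2) by blast
  moreover have "u k \<le> a" "u q \<le> a" using lower_ge(1,2) kq(2) by blast+
  moreover have kr: "k < r" and rq: "r < q" using kk qq r by linarith+
  moreover have "2 ^ j \<le> 2 * (r - k)" by (rule order_trans[OF half(1)]) (use kk in simp)
  moreover have "2 ^ j \<le> 2 * (q - r)" by (rule order_trans[OF half(2)]) (use qq in simp)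
  moreover have len: "q - k < 2 ^ (j + 1)" using B[OF kq(1)] by blast
  ultimately have "peak j k r q w a D"
    unfolding peak_def using less_imp_le[OF w] D(1) by blast
  moreover have "\<bar>r - z * 2 ^ j\<bar> < 2 * 2 ^ j"
  proof -
    have "k < z * 2 ^ j" "z * 2 ^ j \<le> q" using B[OF kq(1)] by blast+
    then show ?thesis using kr rq len by (simp add: abs_less_iff)
  qed
  moreover have "(\<Sum>(k, q)\<in>B. upper k q - lower k q) \<le> 2 * D"
    using sum by (simp add: \<alpha>_def \<beta>_def D_def case_prod_beta)
  ultimately show ?thesis by blast
qed

lemma u_oscillation: "u x - u y \<le> V"
proof -
  have inc: "F s - F t \<le> V" for s t
  proof (cases "s \<le> t")
    case True
    have "F s - F t = - (\<Sum>x\<in>{s..<t}. F (x + 1) - F x)" using sum_increments[OF True, of F] by simp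
    also have "\<dots> \<le> (\<Sum>x\<in>{s..<t}. \<bar>F (x + 1) - F x\<bar>)"
      unfolding sum_negf[symmetric] by (intro sum_mono) auto
    also have "\<dots> \<le> V" by (intro total_variation) auto
    finally show ?thesis .
  next
    case False
    then have "F s - F t = (\<Sum>x\<in>{t..<s}. F (x + 1) - F x)" using sum_increments[of t s F] by simp
    also have "\<dots> \<le> (\<Sum>x\<in>{t..<s}. \<bar>F (x + 1) - F x\<bar>)" by (intro sum_mono) auto
    also have "\<dots> \<le> V" by (intro total_variation) auto
    finally show ?thesis .
  qed
  have "u x \<le> F y + V"
  proof (rule ccontr)
    assume "\<not> ?thesis"
    then obtain w where w: "(2 * real w + 1) * (F y + V) < sum F {x - int w..<x + int w + 1}"
      using nearly_attained[of "F y + V" x] by auto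
    have "sum F {x - int w..<x + int w + 1} \<le> real (card {x - int w..<x + int w + 1}) * (F y + V)"
      using inc by (intro sum_bounded_above) (simp add: algebra_simps)
    also have "real (card {x - int w..<x + int w + 1}) = 2 * real w + 1" by simp
    finally show False using w by simp
  qed
  then show ?thesis using F_le_u[of y] by simp
qed

end

text \<open>
  Both identities describe how the interval of levels between \<open>c\<close> and \<open>M\<close> is cut at \<open>x\<close>.
\<close>

lemma clamp_split:
  fixes M x c :: real
  shows "max 0 (M - c) = max 0 (M - max c x) + max 0 (min M x - c)"
  by (simp add: max_def min_def)

lemma clamp_increment:
  fixes M x c :: real
  shows "max 0 (M - max x c) = max M c - max (min M x) c"
  by (simp add: max_def min_def)

context discrete_maximal
begin

text \<open>
  Consider the levels at which \<open>u\<close> rises from \<open>k\<close> to \<open>k + 1\<close>, and let \<open>q\<close> move to the right. A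
  level stays alive as long as \<open>u\<close> remains above it and \<open>F\<close> does not exceed it. At \<open>q\<close> it is
  charged to \<open>F\<close> if \<open>F q\<close> exceeds it, and it becomes part of the height of the pair \<open>(k, q)\<close> if \<open>u
  q\<close> has dropped to it.
\<close>

definition alive :: "int \<Rightarrow> int \<Rightarrow> real" where "alive k q = max 0 (upper k q - lower0 k q)"

definition charged :: "int \<Rightarrow> int \<Rightarrow> real" where
  "charged k q = max 0 (min (upper k (q + 1)) (F q) - lower0 k q)"

definition height :: "int \<Rightarrow> int \<Rightarrow> real" where "height k q = max 0 (upper k q - lower k q)"

lemma rise_eq: "max 0 (u (k + 1) - u k) = charged k (k + 1) + alive k (k + 2)"
proof -
  have "lower0 k (k + 2) = max (u k) (F (k + 1))"
    using lower0_step(1)[of k] lower0_step(2)[of k "k + 1"] by (simp add: add.assoc)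
  moreover have "upper k (k + 1 + 1) = u (k + 1)" using upper_step(1)[of k] by (simp add: add.assoc)
  ultimately show ?thesis
    using clamp_split[of "u (k + 1)" "u k" "F (k + 1)"]
    by (simp add: charged_def alive_def lower0_step(1) upper_step(1))
qed

lemma alive_step:
  assumes "k + 2 \<le> q"
  shows "alive k q = height k q + charged k q + alive k (q + 1)"
proof -
  have "alive k q = height k q + max 0 (upper k (q + 1) - lower0 k q)"
    using clamp_split[of "upper k q" "lower0 k q" "u q"] upper_step(2)[OF assms]
    by (simp add: alive_def height_def lower_def)
  moreover have "max 0 (upper k (q + 1) - lower0 k q) = charged k q + alive k (q + 1)"
    using clamp_split[of "upper k (q + 1)" "lower0 k q" "F q"] lower0_step(2)[of k q] assms
    by (simp add: alive_def charged_def)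
  ultimately show ?thesis by simp
qed

lemma sum_rises_eq:
  "(\<Sum>k\<in>{x0..<x0 + int n}. max 0 (u (k + 1) - u k)) =
     (\<Sum>q\<in>{x0<..x0 + int n}. \<Sum>k\<in>{x0..<q - 1}. height k q) +
     (\<Sum>q\<in>{x0<..x0 + int n}. \<Sum>k\<in>{x0..<q}. charged k q) +
     (\<Sum>k\<in>{x0..<x0 + int n}. alive k (x0 + int n + 1))"
proof (induction n)
  case (Suc n)
  define y where "y = x0 + int n"
  have y: "x0 \<le> y" "x0 + int (Suc n) = y + 1" by (simp_all add: y_def)
  have s1: "{x0..<y + 1} = insert y {x0..<y}" and s2: "{x0<..y + 1} = insert (y + 1) {x0<..y}" using y by auto
  have "(\<Sum>k\<in>{x0..<y}. alive k (y + 1)) =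
      (\<Sum>k\<in>{x0..<y}. height k (y + 1)) + (\<Sum>k\<in>{x0..<y}. charged k (y + 1)) + (\<Sum>k\<in>{x0..<y}. alive k (y + 2))"
    unfolding sum.distrib[symmetric]
    by (rule sum.cong[OF refl]) (use alive_step[of _ "y + 1"] in \<open>simp add: add.assoc\<close>)
  then show ?case
    using Suc rise_eq[of y] unfolding y(2) y_def[symmetric]
    by (simp add: s1 s2 add.assoc)
qed simp

text \<open>
  A level that is charged at \<open>q\<close> lies between \<open>F (q - 1)\<close> and \<open>F q\<close>, and it is charged for one \<open>k\<close>
  only, the last point before \<open>q\<close> at which \<open>u\<close> is not above the level. In the computation this is a
  telescoping sum.
\<close>

lemma charged_sum_le:
  assumes "x0 < q"
  shows "(\<Sum>k\<in>{x0..<q}. charged k q) \<le> \<bar>F q - F (q - 1)\<bar>"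
proof -
  define c where "c = F (q - 1)"
  \<comment> \<open>These are the caps on the levels charged for \<open>k\<close>; they decrease as \<open>k\<close> moves to the left.\<close>
  define G where "G k = (if q \<le> k + 1 then F q else min (F q) (upper k q))" for k
  have G_step: "G (k - 1) = min (G k) (u k)" if "k < q" for k
  proof -
    have "q = k + 1 \<or> k + 2 \<le> q" using that by linarith
    then show ?thesis
    proof
      assume q: "q = k + 1"
      have "k - 1 + 2 = k + 1" by simp
      then have "upper (k - 1) (k + 1) = u k" using upper_step(1)[of "k - 1"] by (simp only: diff_add_cancel)
      then show ?thesis using q by (simp add: G_def)
    next
      assume k: "k + 2 \<le> q"
      then have "{k - 1<..<q} = insert k {k<..<q}" "k + 1 \<in> {k<..<q}" by auto
      then have eq: "{k - 1<..<q} = insert k {k<..<q}" and ne: "{k<..<q} \<noteq> {}" by blast+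
      have "upper (k - 1) q = min (u k) (upper k q)"
        unfolding upper_def eq image_insert by (rule Min_insert) (use ne in auto)
      then show ?thesis using k by (simp add: G_def min.commute min.left_commute)
    qed
  qed
  have le: "charged k q \<le> max (G k) c - max (G (k - 1)) c" if k: "k < q" for k
  proof -
    have "min (upper k (q + 1)) (F q) \<le> G k"
    proof (cases "q = k + 1")
      case True then show ?thesis by (simp add: G_def)
    next
      case False
      then show ?thesis using upper_step(2)[of k q] k by (auto simp: G_def min.coboundedI1 min.coboundedI2)
    qed
    moreover have "max (u k) c \<le> lower0 k q"
    proof (cases "q = k + 1")
      case True then show ?thesis using F_le_u[of k] by (simp add: lower0_step(1) c_def)
    next
      case False
      then show ?thesis using lower0_ge(1)[of k q] lower0_ge(2)[of k "q - 1" q] k by (simp add: c_def)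
    qed
    ultimately have "charged k q \<le> max 0 (G k - max (u k) c)" unfolding charged_def by linarith
    then show ?thesis unfolding clamp_increment G_step[OF k] .
  qed
  have "(\<Sum>k\<in>{x0..<q}. charged k q) \<le> (\<Sum>k\<in>{x0..<q}. max (G k) c - max (G (k - 1)) c)"
    by (rule sum_mono) (use le in auto)
  also have "\<dots> = max (G (q - 1)) c - max (G (x0 - 1)) c"
    using sum_increments[of x0 q "\<lambda>k. max (G (k - 1)) c"] assms by simp
  also have "\<dots> \<le> max (F q) c - c" by (simp add: G_def)
  also have "\<dots> \<le> \<bar>F q - F (q - 1)\<bar>" by (simp add: c_def max_def)
  finally show ?thesis .
qed

text \<open>
  A level that stays alive up to the end \<open>x1\<close> lies below \<open>u x1\<close>, above the minimum of \<open>u\<close>, and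
  belongs to one \<open>k\<close> only.
\<close>

lemma alive_sum_le: "x0 \<le> x1 \<Longrightarrow> (\<Sum>k\<in>{x0..<x1}. alive k (x1 + 1)) \<le> V"
proof -
  assume x: "x0 \<le> x1"
  define \<nu> where "\<nu> k = Min (u ` {k..x1})" for k
  have step: "alive k (x1 + 1) \<le> \<nu> (k + 1) - \<nu> k" if k: "k < x1" for k
  proof -
    have eq: "{k..x1} = insert k {k + 1..x1}" and eq': "{k<..<x1 + 1} = {k + 1..x1}" using k by auto
    have "\<nu> k = min (u k) (\<nu> (k + 1))"
      unfolding \<nu>_def eq image_insert by (rule Min_insert) (use k in auto)
    moreover have "alive k (x1 + 1) \<le> max 0 (\<nu> (k + 1) - u k)"
      using lower0_ge(1)[of k "x1 + 1"] unfolding alive_def upper_def eq' \<nu>_def by linarith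
    ultimately show ?thesis by (simp add: min_def max_def split: if_splits)
  qed
  have "(\<Sum>k\<in>{x0..<x1}. alive k (x1 + 1)) \<le> (\<Sum>k\<in>{x0..<x1}. \<nu> (k + 1) - \<nu> k)"
    by (rule sum_mono) (use step in auto)
  also have "\<dots> = \<nu> x1 - \<nu> x0" by (rule sum_increments[OF x])
  also have "\<nu> x1 = u x1" by (simp add: \<nu>_def)
  also have "\<nu> x0 \<in> u ` {x0..x1}" unfolding \<nu>_def using x by (intro Min_in) auto
  then obtain y where "\<nu> x0 = u y" by auto
  then have "u x1 - \<nu> x0 \<le> V" using u_oscillation[of x1 y] by simp
  finally show ?thesis .
qed

text \<open>
  A pair \<open>(k, q)\<close> is assigned to the dyadic width \<open>2 ^ j\<close> with \<open>2 ^ j \<le> q - k < 2 ^ (j + 1)\<close> and to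
  the last multiple \<open>z * 2 ^ j\<close> up to \<open>q\<close>, which lies beyond \<open>k\<close>. The pairs assigned to the same
  \<open>(j, z)\<close> merge by \<open>fibre_peak\<close>.
\<close>

lemma heights_sum_le:
  assumes "finite P" and P: "\<And>k q. (k, q) \<in> P \<Longrightarrow> k + 2 \<le> q"
  shows "(\<Sum>(k, q)\<in>P. height k q) \<le> 2 * peak_const * V"
proof -
  define P' where "P' = {(k, q)\<in>P. lower k q < upper k q}"
  have finP': "finite P'" using assms(1) by (auto simp: P'_def intro: finite_subset)
  have "\<exists>j. 2 ^ j \<le> nat (snd x - fst x) \<and> nat (snd x - fst x) < 2 ^ (j + 1)" if "x \<in> P'" for x
    by (rule ex_power_ivl1) (use that P[of "fst x" "snd x"] in \<open>auto simp: P'_def\<close>)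
  then obtain J where J0: "\<And>x. x \<in> P' \<Longrightarrow> 2 ^ J x \<le> nat (snd x - fst x) \<and> nat (snd x - fst x) < 2 ^ (J x + 1)"
    by metis
  have J: "2 ^ J x \<le> snd x - fst x \<and> snd x - fst x < 2 ^ (J x + 1)" if "x \<in> P'" for x
  proof -
    have "fst x < snd x" using that P[of "fst x" "snd x"] by (auto simp: P'_def)
    moreover have "int (2 ^ J x) \<le> int (nat (snd x - fst x))" "int (nat (snd x - fst x)) < int (2 ^ (J x + 1))"
      using J0[OF that] by (simp_all only: of_nat_le_iff of_nat_less_iff)
    ultimately show ?thesis by simp
  qed
  define key where "key x = (J x, snd x div 2 ^ J x)" for x
  define B where "B i = {x\<in>P'. key x = i}" for i
  define \<Phi> where "\<Phi> i p r q w l D \<longleftrightarrow> peak (fst i) p r q w l D \<and> \<bar>r - snd i * 2 ^ fst i\<bar> < 2 * 2 ^ fst i \<and>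
     (\<Sum>(k, q)\<in>B i. upper k q - lower k q) \<le> 2 * D" for i p r q w l D
  have "\<exists>p r q w l D. \<Phi> i p r q w l D" if i: "i \<in> key ` P'" for i
    unfolding \<Phi>_def
  proof (rule fibre_peak)
    show "finite (B i)" using finP' by (simp add: B_def)
    show "B i \<noteq> {}" using i by (auto simp: B_def)
    fix k q assume kq: "(k, q) \<in> B i"
    then have x: "(k, q) \<in> P'" and ji: "J (k, q) = fst i" and zi: "q div 2 ^ fst i = snd i"
      by (auto simp: B_def key_def)
    have len: "2 ^ fst i \<le> q - k" "q - k < 2 ^ (fst i + 1)" using J[OF x] ji by auto
    have "q = snd i * 2 ^ fst i + q mod 2 ^ fst i" unfolding zi[symmetric] by (rule div_mult_mod_eq[symmetric])
    moreover have "0 \<le> q mod 2 ^ fst i" "q mod 2 ^ fst i < 2 ^ fst i" by simp_all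
    ultimately have "k < snd i * 2 ^ fst i" "snd i * 2 ^ fst i \<le> q" using len by linarith+
    then show "k + 2 \<le> q \<and> lower k q < upper k q \<and> 2 ^ fst i \<le> q - k \<and> q - k < 2 ^ (fst i + 1) \<and>
        k < snd i * 2 ^ fst i \<and> snd i * 2 ^ fst i \<le> q"
      using x P len by (auto simp: P'_def)
  qed
  then obtain p r q w l D where "\<And>i. i \<in> key ` P' \<Longrightarrow> \<Phi> i (p i) (r i) (q i) (w i) (l i) (D i)"
    by metis
  then have pk: "\<And>i. i \<in> key ` P' \<Longrightarrow> peak (fst i) (p i) (r i) (q i) (w i) (l i) (D i)"
    "\<And>i. i \<in> key ` P' \<Longrightarrow> \<bar>r i - snd i * 2 ^ fst i\<bar> < 2 * 2 ^ fst i"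
    "\<And>i. i \<in> key ` P' \<Longrightarrow> (\<Sum>(k, q)\<in>B i. upper k q - lower k q) \<le> 2 * D i"
    unfolding \<Phi>_def by blast+
  have "(\<Sum>(k, q)\<in>P. height k q) = (\<Sum>(k, q)\<in>P'. upper k q - lower k q)"
    by (rule sum.mono_neutral_cong_right) (use assms in \<open>auto simp: P'_def height_def\<close>)
  also have "\<dots> = (\<Sum>i\<in>key ` P'. \<Sum>(k, q)\<in>B i. upper k q - lower k q)"
    unfolding B_def by (rule sum.image_gen[OF finP'])
  also have "\<dots> \<le> (\<Sum>i\<in>key ` P'. 2 * D i)" by (rule sum_mono) (rule pk(3))
  also have "\<dots> = 2 * sum D (key ` P')" by (simp add: sum_distrib_left)
  also have "sum D (key ` P') \<le> peak_const * V"
    by (rule all_peaks_bound[OF _ pk(1,2)]) (use finP' in auto)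
  finally show ?thesis by simp
qed

lemma increments_sum_le:
  "(\<Sum>k\<in>{x0..<x0 + int n}. \<bar>u (k + 1) - u k\<bar>) \<le> (4 * peak_const + 5) * V"
proof -
  define x1 where "x1 = x0 + int n"
  have x: "x0 \<le> x1" by (simp add: x1_def)
  have "(\<Sum>q\<in>{x0<..x1}. \<Sum>k\<in>{x0..<q - 1}. height k q) =
      (\<Sum>(q, k)\<in>(SIGMA q:{x0<..x1}. {x0..<q - 1}). height k q)"
    by (rule sum.Sigma) auto
  also have "\<dots> = (\<Sum>(k, q)\<in>prod.swap ` (SIGMA q:{x0<..x1}. {x0..<q - 1}). height k q)"
    by (subst sum.reindex) (auto simp: case_prod_beta intro!: sum.cong)
  also have "\<dots> \<le> 2 * peak_const * V" by (rule heights_sum_le) auto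
  finally have 1: "(\<Sum>q\<in>{x0<..x1}. \<Sum>k\<in>{x0..<q - 1}. height k q) \<le> 2 * peak_const * V" .
  have "(\<Sum>q\<in>{x0<..x1}. \<Sum>k\<in>{x0..<q}. charged k q) \<le> (\<Sum>q\<in>{x0<..x1}. \<bar>F (q - 1 + 1) - F (q - 1)\<bar>)"
    by (rule sum_mono) (use charged_sum_le in auto)
  also have "\<dots> = (\<Sum>y\<in>(\<lambda>q. q - 1) ` {x0<..x1}. \<bar>F (y + 1) - F y\<bar>)"
    by (subst sum.reindex) (auto simp: inj_on_def)
  also have "\<dots> \<le> V" by (rule total_variation) auto
  finally have 2: "(\<Sum>q\<in>{x0<..x1}. \<Sum>k\<in>{x0..<q}. charged k q) \<le> V" .
  have rises: "(\<Sum>k\<in>{x0..<x1}. max 0 (u (k + 1) - u k)) \<le> 2 * peak_const * V + V + V"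
    using sum_rises_eq[of x0 n] 1 2 alive_sum_le[OF x] unfolding x1_def[symmetric] by linarith
  have "(\<Sum>k\<in>{x0..<x1}. \<bar>u (k + 1) - u k\<bar>) = (\<Sum>k\<in>{x0..<x1}. 2 * max 0 (u (k + 1) - u k) - (u (k + 1) - u k))"
    by (rule sum.cong) (auto simp: max_def)
  also have "\<dots> = (\<Sum>k\<in>{x0..<x1}. 2 * max 0 (u (k + 1) - u k)) - (\<Sum>k\<in>{x0..<x1}. u (k + 1) - u k)"
    by (rule sum_subtractf)
  also have "\<dots> = 2 * (\<Sum>k\<in>{x0..<x1}. max 0 (u (k + 1) - u k)) - (u x1 - u x0)"
    by (simp only: sum_increments[OF x] sum_distrib_left)
  also have "\<dots> \<le> 2 * (2 * peak_const * V + V + V) + V"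
    using add_mono[OF mult_left_mono[OF rises, of 2] u_oscillation[of x0 x1]] by simp
  finally show ?thesis unfolding x1_def by (simp add: algebra_simps)
qed

end

section \<open>The centered maximal function\<close>

text \<open>
  Passing to \<open>\<bar>f\<bar>\<close> does not increase the variation.
\<close>

lemma discrete_maximal_of_function:
  fixes f :: "int \<Rightarrow> real"
  assumes "bounded_variation f"
  shows "discrete_maximal (\<lambda>x. \<bar>f x\<bar>) (maximal_function f) (enn2real (variation f))"
proof
  have avg: "centered_average f r w = (\<Sum>x\<in>{r - int w..<r + int w + 1}. \<bar>f x\<bar>) / (2 * real w + 1)" for r w
  proof -
    have "(\<Sum>k = - int w..int w. \<bar>f (r + k)\<bar>) = (\<Sum>x\<in>{r - int w..<r + int w + 1}. \<bar>f x\<bar>)"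
      by (rule sum.reindex_bij_witness[of _ "\<lambda>x. x - r" "\<lambda>k. r + k"]) auto
    then show ?thesis by (simp add: centered_average_def)
  qed
  have bdd: "bdd_above (range (centered_average f r))" for r by (rule bdd_above_centered_average[OF assms])
  show "(\<Sum>x\<in>{r - int w..<r + int w + 1}. \<bar>f x\<bar>) \<le> (2 * real w + 1) * maximal_function f r" for r w
  proof -
    have "centered_average f r w \<le> maximal_function f r"
      unfolding maximal_function_def by (rule cSUP_upper[OF _ bdd]) simp
    then show ?thesis by (simp add: avg field_simps)
  qed
  show "\<exists>w. (2 * real w + 1) * c < (\<Sum>x\<in>{r - int w..<r + int w + 1}. \<bar>f x\<bar>)" if c: "c < maximal_function f r" for c r
  proof -
    obtain w where "c < centered_average f r w"
      using c less_cSUP_iff[OF UNIV_not_empty bdd[of r], of c] unfolding maximal_function_def by blast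
    then show ?thesis by (intro exI[of _ w]) (simp add: avg field_simps)
  qed
  show "(\<Sum>x\<in>A. \<bar>\<bar>f (x + 1)\<bar> - \<bar>f x\<bar>\<bar>) \<le> enn2real (variation f)" if A: "finite A" for A
  proof -
    have "ennreal (\<Sum>x\<in>A. \<bar>f (x + 1) - f x\<bar>) = (\<Sum>x\<in>A. ennreal \<bar>f (x + 1) - f x\<bar>)"
      by (simp add: sum_ennreal)
    also have "\<dots> \<le> variation f"
      unfolding variation_def using A by (subst nonneg_infsum_complete) (auto intro!: SUP_upper)
    finally have le: "ennreal (\<Sum>x\<in>A. \<bar>f (x + 1) - f x\<bar>) \<le> variation f" .
    have "enn2real (ennreal (\<Sum>x\<in>A. \<bar>f (x + 1) - f x\<bar>)) \<le> enn2real (variation f)"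
      by (rule enn2real_mono[OF le]) (use assms in \<open>simp add: bounded_variation_def\<close>)
    then have "(\<Sum>x\<in>A. \<bar>f (x + 1) - f x\<bar>) \<le> enn2real (variation f)"
      by (simp add: sum_nonneg)
    moreover have "(\<Sum>x\<in>A. \<bar>\<bar>f (x + 1)\<bar> - \<bar>f x\<bar>\<bar>) \<le> (\<Sum>x\<in>A. \<bar>f (x + 1) - f x\<bar>)"
      by (rule sum_mono) (rule abs_triangle_ineq3)
    ultimately show ?thesis by simp
  qed
qed

theorem theorem1:
  "\<exists>C::real. C > 0 \<and>
    (\<forall>f :: int \<Rightarrow> real. bounded_variation f \<longrightarrow>
      variation (maximal_function f) \<le> ennreal C * variation f)"
proof (intro exI conjI allI impI)
  show C: "0 < 4 * peak_const + 5" by (simp add: peak_const_def add_nonneg_pos)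
  fix f :: "int \<Rightarrow> real" assume f: "bounded_variation f"
  define V where "V = enn2real (variation f)"
  define u where "u = maximal_function f"
  interpret discrete_maximal "\<lambda>x. \<bar>f x\<bar>" u V
    unfolding u_def V_def by (rule discrete_maximal_of_function[OF f])
  have V: "variation f = ennreal V"
    using f unfolding bounded_variation_def V_def by (simp add: less_top)
  have "(\<Sum>k\<in>A. ennreal \<bar>u (k + 1) - u k\<bar>) \<le> ennreal ((4 * peak_const + 5) * V)" if A: "finite A" for A
  proof -
    define B where "B = (\<Sum>k\<in>A. \<bar>k\<bar>)"
    have B: "\<bar>k\<bar> \<le> B" if "k \<in> A" for k unfolding B_def by (rule member_le_sum) (use that A in auto)
    have "(\<Sum>k\<in>A. \<bar>u (k + 1) - u k\<bar>) \<le> (\<Sum>k\<in>{- B..<- B + int (nat (2 * B + 1))}. \<bar>u (k + 1) - u k\<bar>)"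
      by (rule sum_mono2) (use B in \<open>force simp: abs_le_iff\<close>)+
    also have "\<dots> \<le> (4 * peak_const + 5) * V" by (rule increments_sum_le)
    finally show ?thesis by (simp add: sum_ennreal ennreal_leI)
  qed
  then have "variation u \<le> ennreal ((4 * peak_const + 5) * V)"
    unfolding variation_def by (subst nonneg_infsum_complete) (auto intro!: SUP_least)
  also have "\<dots> = ennreal (4 * peak_const + 5) * variation f"
    unfolding V using C by (intro ennreal_mult'') (rule V_nonneg)
  finally show "variation (maximal_function f) \<le> ennreal (4 * peak_const + 5) * variation f"
    by (simp add: u_def)
qed

end
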